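(* Let $k\geq1$ be an integer and let $\mu$ be the surface measure on the graph of the $(k,1)$-additive Brownian sheet in $\mathbb{R}^{k+1}$. Then, almost surely, for $p,q\in[1,\infty]$ the extension estimate $$\|\widehat{f\mu}\|_{L^q(\mathbb{R}^{k+1})}\lesssim\|f\|_{L^p(\mu)}\quad\text{for all } f\in L^p(\mu)$$ cannot hold whenever $$q<2+\frac1k.$$ Equivalently (by duality, in the case $p=2$), the restriction estimate $$\|\widehat f\,\|_{L^2(\mu)}\lesssim\|f\|_{L^{q'}(\mathbb{R}^{k+1})}\quad\text{for all } f\in L^{q'}(\mathbb{R}^{k+1})$$ cannot hold whenever $$q'>\frac{2k+1}{k+1}.$$
   Context: The $(k,1)$-additive Brownian sheet is the random map $W:[0,1]^k\to\mathbb{R}$ given by $W(t)=\sum_{i=1}^k W^i(t_i)$ for $t=(t_1,\dots,t_k)\in[0,1]^k$, where $W^1,\dots,W^k:[0,1]\to\mathbb{R}$ are independent standard one-parameter Brownian motions (almost surely continuous, $W^i(0)=0$). Its graph is $G(W)=\{(t,W(t)):t\in[0,1]^k\}\subset\mathbb{R}^{k+1}$, and the surface measure $\mu$ on it is the Borel measure on $\mathbb{R}^{k+1}$ given by $\mu(E)=\mathcal{L}^k\{t\in[0,1]^k:(t,W(t))\in E\}$ for Borel $E\subset\mathbb{R}^{k+1}$, where $\mathcal{L}^k$ is $k$-dimensional Lebesgue measure. Here $\widehat{f\mu}(\xi)=\int e^{-2\pi i\xi\cdot x}f(x)\,d\mu(x)$ and $\widehat f$ is the Fourier transform on $\mathbb{R}^{k+1}$.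 The notation $A\lesssim B$ means there is a finite constant $c$, independent of $f$ (but possibly depending on the realisation of $W$), with $A\leq cB$. The exponent $q'$ is the Hölder conjugate of $q$, $\frac1q+\frac1{q'}=1$. The restriction estimate is understood in the usual a priori sense, as an inequality with a uniform constant for Schwartz functions $f$. *)

theory Defs
  imports "HOL-Probability.Probability"
begin

text \<open>Standard one-parameter Brownian motion on the time interval \<open>[0,1]\<close>; only the values
  \<open>B t\<close> with \<open>0 \<le> t \<le> 1\<close> matter.\<close>

definition standard_brownian_motion :: "'w measure \<Rightarrow> (real \<Rightarrow> 'w \<Rightarrow> real) \<Rightarrow> bool" where
  "standard_brownian_motion M B \<longleftrightarrow>
     prob_space M \<and>
     (\<forall>t\<in>{0..1}. B t \<in> borel_measurable M) \<and>
     (AE \<omega> in M. B 0 \<omega> = 0 \<and> continuous_on {0..1} (\<lambda>t. B t \<omega>)) \<and>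
     (\<forall>(n::nat) t. 0 \<le> t 0 \<and> (\<forall>i<n. t i < t (Suc i)) \<and> t n \<le> 1 \<longrightarrow>
        prob_space.indep_vars M (\<lambda>_. borel) (\<lambda>i \<omega>. B (t (Suc i)) \<omega> - B (t i) \<omega>) {..<n}) \<and>
     (\<forall>s t. 0 \<le> s \<and> s < t \<and> t \<le> 1 \<longrightarrow>
        distributed M lborel (\<lambda>\<omega>. B t \<omega> - B s \<omega>) (normal_density 0 (sqrt (t - s))))"

text \<open>Independence of whole processes: the path maps into the product space
  \<open>\<real>\<^bsup>[0,1]\<^esup>\<close> with its product sigma-algebra are independent.\<close>

definition independent_brownian_motions ::
    "'w measure \<Rightarrow> ('k \<Rightarrow> real \<Rightarrow> 'w \<Rightarrow> real) \<Rightarrow> bool" where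
  "independent_brownian_motions M W \<longleftrightarrow>
     (\<forall>i. standard_brownian_motion M (W i)) \<and>
     prob_space.indep_vars M (\<lambda>_. PiM {0..1} (\<lambda>_. borel))
       (\<lambda>i \<omega>. \<lambda>t\<in>{0..1}. W i t \<omega>) UNIV"

definition unit_cube :: "(real ^ 'k) set" where
  "unit_cube = {t. \<forall>i. 0 \<le> t $ i \<and> t $ i \<le> 1}"

definition additive_sheet :: "('k::finite \<Rightarrow> real \<Rightarrow> real) \<Rightarrow> (real ^ 'k) \<Rightarrow> real" where
  "additive_sheet w t = (\<Sum>i\<in>UNIV. w i (t $ i))"

text \<open>The ambient space \<open>\<real>\<^bsup>k+1\<^esup>\<close> is rendered as \<open>\<real>\<^sup>k \<times> \<real>\<close>, whose inner product, Lebesgue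
  measure and Borel sets are those of Euclidean space of dimension \<open>k + 1\<close>.\<close>

definition surface_measure :: "((real ^ 'k::finite) \<Rightarrow> real) \<Rightarrow> ((real ^ 'k) \<times> real) measure" where
  "surface_measure X = distr (restrict_space lborel unit_cube) borel (\<lambda>t. (t, X t))"

lemma sets_surface_measure [simp, measurable_cong]: "sets (surface_measure X) = sets borel"
  by (simp add: surface_measure_def)

lemma unit_cube_borel [measurable]: "(unit_cube :: (real ^ 'k::finite) set) \<in> sets borel"
proof -
  have "(unit_cube :: (real ^ 'k) set) = cbox 0 (\<chi> i. 1)"
    by (auto simp: unit_cube_def mem_box_cart)
  then have "closed (unit_cube :: (real ^ 'k) set)"
    by (metis closed_cbox)
  then show ?thesis by (rule borel_closed)
qed

lemma emeasure_surface_measure: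
  assumes X: "continuous_on unit_cube X" and E: "E \<in> sets borel"
  shows "emeasure (surface_measure X) E = emeasure lborel {t \<in> unit_cube. (t, X t) \<in> E}"
proof -
  have "(\<lambda>t. (t, X t)) \<in> borel_measurable (restrict_space lborel unit_cube)"
    using borel_measurable_continuous_on_restrict[OF continuous_on_Pair[OF continuous_on_id X]]
    by (simp add: measurable_cong_sets[OF sets_restrict_space_cong[OF sets_lborel] refl])
  then show ?thesis
    using E by (simp add: surface_measure_def emeasure_distr emeasure_restrict_space
        space_restrict_space vimage_def Int_def conj_commute)
qed

text \<open>\<open>L\<^sup>p\<close>-(semi)norm for \<open>1 \<le> p \<le> \<infinity>\<close>; the value is \<open>\<infinity>\<close> when the function is not
  \<open>p\<close>-integrable. The case distinction on \<open>I\<close> is just \<open>I\<^bsup>1/p\<^esup>\<close> in \<open>[0,\<infinity>]\<close>.\<close>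

definition Lp_norm :: "'a measure \<Rightarrow> ennreal \<Rightarrow> ('a \<Rightarrow> complex) \<Rightarrow> ennreal" where
  "Lp_norm M p f =
     (if p = \<top> then esssup M (\<lambda>x. ennreal (norm (f x)))
      else let I = (\<integral>\<^sup>+x. ennreal (norm (f x) powr enn2real p) \<partial>M)
           in if I = \<top> then \<top> else ennreal (enn2real I powr (1 / enn2real p)))"

definition Lp_space :: "'a measure \<Rightarrow> ennreal \<Rightarrow> ('a \<Rightarrow> complex) set" where
  "Lp_space M p = {f \<in> borel_measurable M. Lp_norm M p f < \<top>}"

text \<open>Fourier transform of the complex measure \<open>f M\<close>. It covers both
  \<open>\<xi> \<mapsto> \<integral> e\<^bsup>-2\<pi>i\<xi>\<cdot>x\<^esup> f(x) d\<mu>(x)\<close>, for \<open>M = \<mu>\<close>, and the Fourier transform of the function \<open>f\<close>,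
  for \<open>M = lborel\<close>.\<close>

definition fourier :: "'a::euclidean_space measure \<Rightarrow> ('a \<Rightarrow> complex) \<Rightarrow> 'a \<Rightarrow> complex" where
  "fourier M f \<xi> = (LINT x|M. cis (- 2 * pi * (\<xi> \<bullet> x)) * f x)"

primrec iterated_partial ::
    "'a list \<Rightarrow> ('a::euclidean_space \<Rightarrow> complex) \<Rightarrow> 'a \<Rightarrow> complex" where
  "iterated_partial [] f = f"
| "iterated_partial (b # bs) f = (\<lambda>x. frechet_derivative (iterated_partial bs f) (at x) b)"

text \<open>The first conjunct says that \<open>f\<close> is smooth: every iterated partial derivative is
  differentiable, hence continuous.\<close>

definition schwartz :: "('a::euclidean_space \<Rightarrow> complex) \<Rightarrow> bool" where
  "schwartz f \<longleftrightarrow>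
     (\<forall>bs\<in>lists Basis. iterated_partial bs f differentiable_on UNIV) \<and>
     (\<forall>bs\<in>lists Basis. \<forall>N::nat. \<exists>C. \<forall>x. norm x ^ N * norm (iterated_partial bs f x) \<le> C)"

definition extension_estimate :: "'a::euclidean_space measure \<Rightarrow> ennreal \<Rightarrow> ennreal \<Rightarrow> bool" where
  "extension_estimate \<mu> p q \<longleftrightarrow>
     (\<exists>c::real. \<forall>f\<in>Lp_space \<mu> p. Lp_norm lborel q (fourier \<mu> f) \<le> ennreal c * Lp_norm \<mu> p f)"

text \<open>The restriction estimate in the a priori sense, i.e. tested on Schwartz functions.\<close>

definition restriction_estimate :: "'a::euclidean_space measure \<Rightarrow> ennreal \<Rightarrow> bool" where
  "restriction_estimate \<mu> r \<longleftrightarrow>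
     (\<exists>c::real. \<forall>f. schwartz f \<longrightarrow>
        Lp_norm \<mu> 2 (fourier lborel f) \<le> ennreal c * Lp_norm lborel r f)"

text \<open>In \<open>[0,\<infinity>]\<close> we have \<open>inverse \<infinity> = 0\<close> and \<open>inverse 0 = \<infinity>\<close>, so this includes the pairs
  \<open>(1,\<infinity>)\<close> and \<open>(\<infinity>,1)\<close> and forces both exponents to be at least \<open>1\<close>.\<close>

definition hoelder_conjugate :: "ennreal \<Rightarrow> ennreal \<Rightarrow> bool" where
  "hoelder_conjugate q q' \<longleftrightarrow> inverse q + inverse q' = 1"

end

theory Submission
  imports Defs
begin

text \<open>Both estimates are tested against the anisotropic Gaussian
  \<open>G(x,y) = exp(-\<pi>(r\<^sup>2\<bar>x\<bar>\<^sup>2 + (r/L) y\<^sup>2))\<close> on \<open>\<real>\<^sup>k \<times> \<real>\<close>, which respects the parabolic scaling of Brownian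
  paths. The key quantity is the energy of the surface measure against \<open>exp(-2\<pi>(\<bar>x\<bar>\<^sup>2/r\<^sup>2 + L y\<^sup>2/r))\<close>,
  which almost surely is at least \<open>c r\<^sup>k\<close> along some sequence \<open>r \<rightarrow> 0\<close>: since \<open>E(B\<^sub>a - B\<^sub>b)\<^sup>2 = \<bar>a - b\<bar>\<close>,
  Fatou's lemma bounds the mean square oscillation of the paths at scale \<open>r\<close> infinitely often.

  For the extension estimate take \<open>f = 1\<close>, which reduces all \<open>p\<close> to one statement about the Fourier
  transform \<open>F\<close> of \<open>\<mu>\<close>: the Gaussian-weighted \<open>L\<^sup>2\<close> mass of \<open>F\<close> is at least \<open>c r\<^bsup>-1/2\<^esup>\<close>, too large for
  \<open>F \<in> L\<^sup>q\<close> with \<open>2 < q < 2 + 1/k\<close>; smaller \<open>q\<close> reduce to this case because \<open>\<bar>F\<bar> \<le> 1\<close>. For the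
  restriction estimate take \<open>f(x) = e\<^bsup>2\<pi>iz\<cdot>x\<^esup> G(x)\<close> and average over \<open>z\<close> with respect to \<open>\<mu>\<close>.\<close>

section \<open>Gaussians and their Fourier transforms\<close>

text \<open>The function \<open>a\<close> gives each coordinate direction its own dilation. With the
  factor \<open>pi\<close>, the Gaussian with all weights 1 is its own Fourier transform.\<close>

definition gaussian :: "('a::euclidean_space \<Rightarrow> real) \<Rightarrow> 'a \<Rightarrow> real" where
  "gaussian a x = exp (- pi * (\<Sum>b\<in>Basis. (a b * (x \<bullet> b))\<^sup>2))"

lemma gaussian_pos: "0 < gaussian a x"
  and gaussian_le_1: "gaussian a x \<le> 1"
  and gaussian_minus: "gaussian a (- x) = gaussian a x"
  by (auto simp: gaussian_def sum_nonneg)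

lemma gaussian_eq_prod: "gaussian a x = (\<Prod>b\<in>Basis. exp (- pi * (a b * (x \<bullet> b))\<^sup>2))"
  unfolding gaussian_def sum_distrib_left by (rule exp_sum) simp

lemma borel_measurable_gaussian [measurable]: "gaussian a \<in> borel_measurable borel"
  unfolding gaussian_def by measurable

text \<open>The substitution y = c x with c = sqrt(2 pi) a turns pi (a x)^2 into y^2 / 2, so the
  integral becomes the characteristic function of the standard normal law at
  \<open>t\<close>.\<close>

lemma fourier_gaussian_real:
  fixes a u :: real
  assumes a: "0 < a"
  shows "integrable lborel (\<lambda>x. cis (- 2 * pi * (u * x)) * exp (- pi * (a * x)\<^sup>2))"
    and "(LINT x|lborel. cis (- 2 * pi * (u * x)) * exp (- pi * (a * x)\<^sup>2))
      = of_real (exp (- pi * (u / a)\<^sup>2) / a)"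
proof -
  define c where "c = sqrt (2 * pi) * a"
  have c: "c > 0" and c2: "c\<^sup>2 = 2 * pi * a\<^sup>2"
    using a by (simp_all add: c_def power_mult_distrib)
  define t where "t = - 2 * pi * u / c"
  define g where "g y = std_normal_density y *\<^sub>R iexp (t * y)" for y
  have g: "integrable lborel g"
  proof (rule Bochner_Integration.integrable_bound[of lborel std_normal_density])
    show "AE x in lborel. norm (g x) \<le> norm (std_normal_density x)"
      by (simp add: g_def normal_density_def norm_mult)
  qed (auto simp: g_def[abs_def])
  have lg: "(LINT y|lborel. g y) = of_real (exp (- (t\<^sup>2) / 2))"
    using char_std_normal_distribution
    by (simp add: fun_eq_iff char_def g_def integral_density)
  have eq: "cis (- 2 * pi * (u * x)) * exp (- pi * (a * x)\<^sup>2) = sqrt (2 * pi) *\<^sub>R g (0 + c * x)" for x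
  proof -
    have "- (c * x)\<^sup>2 / 2 = - pi * (a * x)\<^sup>2"
      using c2 by (simp add: power_mult_distrib)
    moreover have "t * (c * x) = - 2 * pi * (u * x)"
      using c by (simp add: t_def)
    ultimately show ?thesis
      by (simp only: g_def std_normal_density_def cis_conv_exp scaleR_conv_of_real add_0_left)
        (simp flip: cis_conv_exp)
  qed
  show "integrable lborel (\<lambda>x. cis (- 2 * pi * (u * x)) * exp (- pi * (a * x)\<^sup>2))"
    unfolding eq using c g by (intro integrable_scaleR_right lborel_integrable_real_affine) auto
  have "(LINT y|lborel. g y) = c *\<^sub>R (LINT x|lborel. g (0 + c * x))"
    using lborel_integral_real_affine[of c g 0] c by simp
  then have "(LINT x|lborel. g (0 + c * x)) = of_real (exp (- (t\<^sup>2) / 2)) /\<^sub>R c"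
    using c lg by simp
  moreover have "t\<^sup>2 / 2 = pi * (u / a)\<^sup>2"
    using a by (simp add: t_def power_divide c2 power_mult_distrib) (simp add: field_simps power2_eq_square)
  ultimately show "(LINT x|lborel. cis (- 2 * pi * (u * x)) * exp (- pi * (a * x)\<^sup>2))
      = of_real (exp (- pi * (u / a)\<^sup>2) / a)"
    unfolding eq using c by (simp add: c_def scaleR_conv_of_real field_simps)
qed

text \<open>Lebesgue measure on a Euclidean space is the image of a product of one-dimensional
  Lebesgue measures indexed by \<open>Basis\<close>, so Fubini for finite products applies.\<close>

lemma
  fixes f :: "'a::euclidean_space \<Rightarrow> real \<Rightarrow> 'b::{real_normed_field,banach,second_countable_topology}"
  assumes f: "\<And>b. b \<in> Basis \<Longrightarrow> integrable lborel (f b)"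
  shows integrable_prod_Basis: "integrable lborel (\<lambda>x. \<Prod>b\<in>Basis. f b (x \<bullet> b))"
    and integral_prod_Basis:
      "(LINT x|lborel. (\<Prod>b\<in>Basis. f b (x \<bullet> b))) = (\<Prod>b\<in>Basis. (LINT x|lborel. f b x))"
proof -
  interpret product_sigma_finite "\<lambda>b::'a. lborel :: real measure"
    by unfold_locales
  let ?P = "Pi\<^sub>M Basis (\<lambda>b::'a. lborel :: real measure)"
  let ?T = "\<lambda>y. \<Sum>b\<in>Basis. y b *\<^sub>R (b::'a)"
  have L: "(lborel :: 'a measure) = distr ?P borel ?T"
    unfolding lborel_eq_real by (rule lborel_def)
  have T: "?T \<in> measurable ?P borel"
    by measurable
  have [measurable]: "f b \<in> borel_measurable borel" if "b \<in> Basis" for b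
    using borel_measurable_integrable[OF f[OF that]] by simp
  have F: "(\<lambda>x. \<Prod>b\<in>Basis. f b (x \<bullet> b)) \<in> borel_measurable borel"
    by measurable
  have eq: "(\<Prod>b\<in>Basis. f b (?T y \<bullet> b)) = (\<Prod>b\<in>Basis. f b (y b))" for y
    by (intro prod.cong) (simp_all add: inner_sum_left inner_Basis if_distrib cong: if_cong)
  show "integrable lborel (\<lambda>x. \<Prod>b\<in>Basis. f b (x \<bullet> b))"
    unfolding L integrable_distr_eq[OF T F] eq by (intro product_integrable_prod finite_Basis f)
  show "(LINT x|lborel. (\<Prod>b\<in>Basis. f b (x \<bullet> b))) = (\<Prod>b\<in>Basis. (LINT x|lborel. f b x))"
    unfolding L integral_distr[OF T F] eq by (intro product_integral_prod finite_Basis f)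
qed

text \<open>The character and the Gaussian both factor over \<open>Basis\<close>, which leaves
  one-dimensional transforms.\<close>

lemma
  fixes a :: "'a::euclidean_space \<Rightarrow> real" and \<xi> :: 'a
  assumes a: "\<And>b. b \<in> Basis \<Longrightarrow> 0 < a b"
  shows integrable_fourier_gaussian:
      "integrable lborel (\<lambda>x. cis (- 2 * pi * (\<xi> \<bullet> x)) * gaussian a x)"
    and fourier_gaussian: "fourier lborel (\<lambda>x. gaussian a x) \<xi>
      = of_real ((\<Prod>b\<in>Basis. inverse (a b)) * gaussian (\<lambda>b. inverse (a b)) \<xi>)"
proof -
  define h where "h b x = cis (- 2 * pi * ((\<xi> \<bullet> b) * x)) * exp (- pi * (a b * x)\<^sup>2)" for b x
  have h: "cis (- 2 * pi * (\<xi> \<bullet> x)) * gaussian a x = (\<Prod>b\<in>Basis. h b (x \<bullet> b))" for x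
  proof -
    have "(\<Prod>b\<in>Basis. cis (- 2 * pi * ((\<xi> \<bullet> b) * (x \<bullet> b)))) = cis (- 2 * pi * (\<xi> \<bullet> x))"
      by (simp add: cis_conv_exp exp_sum[symmetric] euclidean_inner[of \<xi> x] sum_distrib_left
          sum_negf)
    then show ?thesis
      unfolding h_def prod.distrib gaussian_eq_prod of_real_prod by simp
  qed
  show "integrable lborel (\<lambda>x. cis (- 2 * pi * (\<xi> \<bullet> x)) * gaussian a x)"
    unfolding h by (rule integrable_prod_Basis) (unfold h_def, intro fourier_gaussian_real a)
  have "fourier lborel (\<lambda>x. gaussian a x) \<xi> = (\<Prod>b\<in>Basis. (LINT x|lborel. h b x))"
    unfolding fourier_def h by (rule integral_prod_Basis) (unfold h_def, intro fourier_gaussian_real a)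
  also have "\<dots> = (\<Prod>b\<in>Basis. of_real (exp (- pi * ((\<xi> \<bullet> b) / a b)\<^sup>2) / a b))"
    by (intro prod.cong refl) (use fourier_gaussian_real(2) a in \<open>simp add: h_def\<close>)
  also have "\<dots> = of_real ((\<Prod>b\<in>Basis. inverse (a b)) * gaussian (\<lambda>b. inverse (a b)) \<xi>)"
    unfolding gaussian_eq_prod prod.distrib[symmetric] of_real_prod[symmetric]
    by (intro arg_cong[of _ _ of_real] prod.cong) (simp_all add: field_simps)
  finally show "fourier lborel (\<lambda>x. gaussian a x) \<xi>
      = of_real ((\<Prod>b\<in>Basis. inverse (a b)) * gaussian (\<lambda>b. inverse (a b)) \<xi>)" .
qed

lemma
  fixes a :: "'a::euclidean_space \<Rightarrow> real"
  assumes a: "\<And>b. b \<in> Basis \<Longrightarrow> 0 < a b"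
  shows integrable_gaussian: "integrable lborel (gaussian a)"
    and integral_gaussian: "(LINT x|lborel. gaussian a x) = (\<Prod>b\<in>Basis. inverse (a b))"
proof -
  \<comment> \<open>At frequency 0 the Fourier transform is the plain integral.\<close>
  have 0: "integrable lborel (\<lambda>x. complex_of_real (gaussian a x))"
    using integrable_fourier_gaussian[OF a, where \<xi> = 0] by simp
  then show "integrable lborel (gaussian a)"
    by (simp add: complex_of_real_integrable_eq)
  have "complex_of_real (LINT x|lborel. gaussian a x) = of_real (\<Prod>b\<in>Basis. inverse (a b))"
    using fourier_gaussian[OF a, where \<xi> = 0]
    by (simp add: fourier_def gaussian_def[of _ 0] del: of_real_prod)
  then show "(LINT x|lborel. gaussian a x) = (\<Prod>b\<in>Basis. inverse (a b))"
    using of_real_eq_iff by blast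
qed

lemma nn_integral_gaussian:
  assumes "\<And>b. b \<in> Basis \<Longrightarrow> 0 < a b"
  shows "(\<integral>\<^sup>+x. gaussian a x \<partial>lborel) = ennreal (\<Prod>b\<in>Basis. inverse (a b))"
  using assms by (simp add: nn_integral_eq_integral integrable_gaussian integral_gaussian
      gaussian_pos less_imp_le)

text \<open>Lets one Gaussian supply test functions whose transforms are centred at any prescribed
  \<open>z\<close>, in particular at points of the surface.\<close>

lemma fourier_modulation:
  "fourier M (\<lambda>x. cis (2 * pi * (z \<bullet> x)) * f x) \<xi> = fourier M f (\<xi> - z)"
  unfolding fourier_def
  by (intro Bochner_Integration.integral_cong refl)
    (simp add: mult.assoc[symmetric] cis_mult inner_diff_left right_diff_distrib)

section \<open>Modulated Gaussians are Schwartz functions\<close>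

text \<open>Complex polynomial functions of the coordinates, generated inductively so that growth
  and differentiation follow by rule induction.\<close>

inductive poly_fun :: "('a::euclidean_space \<Rightarrow> complex) \<Rightarrow> bool" where
  poly_const: "poly_fun (\<lambda>x. c)"
| poly_inner: "poly_fun (\<lambda>x. of_real (x \<bullet> b))"
| poly_add: "poly_fun p \<Longrightarrow> poly_fun r \<Longrightarrow> poly_fun (\<lambda>x. p x + r x)"
| poly_mult: "poly_fun p \<Longrightarrow> poly_fun r \<Longrightarrow> poly_fun (\<lambda>x. p x * r x)"

lemma poly_fun_sum:
  assumes "finite A" "\<And>i. i \<in> A \<Longrightarrow> poly_fun (p i)"
  shows "poly_fun (\<lambda>x. \<Sum>i\<in>A. p i x)"
  using assms by (induction rule: finite_induct) (auto intro: poly_fun.intros)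

lemma poly_fun_growth:
  "poly_fun p \<Longrightarrow> \<exists>C m. 0 \<le> C \<and> (\<forall>x. norm (p x) \<le> C * (1 + norm x) ^ m)"
proof (induction rule: poly_fun.induct)
  case (poly_const c)
  show ?case by (intro exI[of _ "norm c"] exI[of _ 0]) simp
next
  case (poly_inner b)
  have "norm (complex_of_real (x \<bullet> b)) \<le> norm b * (1 + norm x) ^ 1" for x
    using Cauchy_Schwarz_ineq2[of x b] norm_ge_zero[of b]
    by (simp add: distrib_left mult.commute[of "norm b"] add_increasing)
  then show ?case using norm_ge_zero by blast
next
  case (poly_add p r)
  then obtain C m D n where p: "0 \<le> C" "\<And>x. norm (p x) \<le> C * (1 + norm x) ^ m"
    and r: "0 \<le> D" "\<And>x. norm (r x) \<le> D * (1 + norm x) ^ n" by blast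
  have "norm (p x + r x) \<le> (C + D) * (1 + norm x) ^ (m + n)" for x
  proof -
    have "norm (p x + r x) \<le> C * (1 + norm x) ^ m + D * (1 + norm x) ^ n"
      using norm_triangle_ineq p(2) r(2) add_mono order_trans by metis
    also have "\<dots> \<le> C * (1 + norm x) ^ (m + n) + D * (1 + norm x) ^ (m + n)"
      using p(1) r(1) by (intro add_mono mult_left_mono power_increasing) auto
    finally show ?thesis by (simp add: distrib_right)
  qed
  then show ?case using p(1) r(1) add_nonneg_nonneg by blast
next
  case (poly_mult p r)
  then obtain C m D n where p: "0 \<le> C" "\<And>x. norm (p x) \<le> C * (1 + norm x) ^ m"
    and r: "0 \<le> D" "\<And>x. norm (r x) \<le> D * (1 + norm x) ^ n" by blast
  have "norm (p x * r x) \<le> (C * D) * (1 + norm x) ^ (m + n)" for x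
    using mult_mono[OF p(2)[of x] r(2)[of x]] p(1)
    by (simp add: norm_mult power_add mult_ac)
  then show ?case using p(1) r(1) mult_nonneg_nonneg by blast
qed

lemma poly_fun_has_derivative:
  "poly_fun p \<Longrightarrow> \<exists>p'. (\<forall>x. (p has_derivative p' x) (at x)) \<and> (\<forall>b. poly_fun (\<lambda>x. p' x b))"
proof (induction rule: poly_fun.induct)
  case (poly_const c)
  show ?case by (intro exI[of _ "\<lambda>x b. 0"]) (auto intro: poly_fun.intros)
next
  case (poly_inner v)
  show ?case by (intro exI[of _ "\<lambda>x b. of_real (b \<bullet> v)"])
    (auto intro!: poly_fun.intros derivative_eq_intros)
next
  case (poly_add p r)
  then obtain p' r' where "\<forall>x. (p has_derivative p' x) (at x)" "\<forall>b. poly_fun (\<lambda>x. p' x b)"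
    and "\<forall>x. (r has_derivative r' x) (at x)" "\<forall>b. poly_fun (\<lambda>x. r' x b)" by blast
  then show ?case by (intro exI[of _ "\<lambda>x b. p' x b + r' x b"])
    (auto intro!: poly_fun.intros has_derivative_add)
next
  case (poly_mult p r)
  then obtain p' r' where "\<forall>x. (p has_derivative p' x) (at x)" "\<forall>b. poly_fun (\<lambda>x. p' x b)"
    and "\<forall>x. (r has_derivative r' x) (at x)" "\<forall>b. poly_fun (\<lambda>x. r' x b)" by blast
  then show ?case using poly_mult(1,2) by (intro exI[of _ "\<lambda>x b. p x * r' x b + p' x b * r x"])
    (auto intro!: poly_fun.intros has_derivative_mult)
qed

text \<open>By the product and chain rules, differentiating p e^q in direction b keeps e^q and
  replaces p by p'_b + p q'_b, again a polynomial. This makes the class stable under iterated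
  partial derivatives.\<close>

lemma poly_exp_has_derivative:
  assumes "poly_fun p" "poly_fun q"
  shows "\<exists>s. (\<forall>x. ((\<lambda>x. p x * exp (q x)) has_derivative (\<lambda>b. s b x * exp (q x))) (at x)) \<and>
    (\<forall>b. poly_fun (s b))"
proof -
  obtain p' q' where p: "\<And>x. (p has_derivative p' x) (at x)" "\<And>b. poly_fun (\<lambda>x. p' x b)"
    and q: "\<And>x. (q has_derivative q' x) (at x)" "\<And>b. poly_fun (\<lambda>x. q' x b)"
    using assms poly_fun_has_derivative by metis
  have e: "((\<lambda>x. exp (q x)) has_derivative (\<lambda>b. exp (q x) * q' x b)) (at x)" for x
    using has_derivative_compose[OF q(1) DERIV_exp[unfolded has_field_derivative_def]] by simp
  have "((\<lambda>x. p x * exp (q x)) has_derivative (\<lambda>b. (p' x b + p x * q' x b) * exp (q x))) (at x)"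
    for x
    by (rule has_derivative_eq_rhs[OF has_derivative_mult[OF p(1) e]]) (auto simp: algebra_simps)
  moreover have "poly_fun (\<lambda>x. p' x b + p x * q' x b)" for b
    using assms(1) p(2) q(2) by (auto intro!: poly_fun.intros)
  ultimately show ?thesis
    by (intro exI[of _ "\<lambda>b x. p' x b + p x * q' x b"]) blast
qed

lemma iterated_partial_poly_exp:
  assumes "poly_fun p" "poly_fun q"
  shows "\<exists>s. poly_fun s \<and> iterated_partial bs (\<lambda>x. p x * exp (q x)) = (\<lambda>x. s x * exp (q x))"
proof (induction bs)
  case Nil
  then show ?case using assms by auto
next
  case (Cons b bs)
  then obtain s where s: "poly_fun s"
    and eq: "iterated_partial bs (\<lambda>x. p x * exp (q x)) = (\<lambda>x. s x * exp (q x))" by blast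
  obtain s' where s': "\<And>x. ((\<lambda>x. s x * exp (q x)) has_derivative (\<lambda>b. s' b x * exp (q x))) (at x)"
    and "poly_fun (s' b)"
    using poly_exp_has_derivative[OF s assms(2)] by blast
  moreover have "frechet_derivative (\<lambda>x. s x * exp (q x)) (at x) = (\<lambda>b. s' b x * exp (q x))" for x
    using frechet_derivative_at[OF s'] by simp
  ultimately show ?case by (auto simp: eq)
qed

text \<open>Since 1 + t is at most 2 max(1, t), it suffices to control t^(2m), and this is done by
  the m-th term of the exponential series of c t^2.\<close>

lemma power_times_exp_le:
  fixes t :: real
  assumes "0 \<le> t" "0 < c"
  shows "(1 + t) ^ m * exp (- c * t\<^sup>2) \<le> 2 ^ m * (1 + fact m / c ^ m)"
proof -
  have "(1 + t) ^ m \<le> (2 * max 1 t) ^ m"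
    using assms by (intro power_mono) auto
  also have "\<dots> \<le> 2 ^ m * (1 + t ^ (2 * m))"
  proof (cases "t \<le> 1")
    case True
    then show ?thesis using assms by (simp add: max_def power_mult_distrib)
  next
    case False
    then show ?thesis
      using power_increasing[of m "2 * m" t] by (simp add: max_def power_mult_distrib add_increasing)
  qed
  finally have "(1 + t) ^ m * exp (- c * t\<^sup>2) \<le> 2 ^ m * (1 + t ^ (2 * m)) * exp (- c * t\<^sup>2)"
    by (rule mult_right_mono) simp
  also have "\<dots> = 2 ^ m * (exp (- c * t\<^sup>2) + t ^ (2 * m) * exp (- c * t\<^sup>2))"
    by (simp add: algebra_simps)
  also have "\<dots> \<le> 2 ^ m * (1 + fact m / c ^ m)"
  proof (intro mult_left_mono add_mono)
    have "(c * t\<^sup>2) ^ m / fact m \<le> exp (c * t\<^sup>2)"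
      using sum_le_suminf[OF summable_exp, of "{m}" "c * t\<^sup>2"] assms
      by (simp add: exp_def divide_inverse scaleR_conv_of_real mult.commute)
    then show "t ^ (2 * m) * exp (- c * t\<^sup>2) \<le> fact m / c ^ m"
      using assms by (simp add: exp_minus power_mult field_simps power2_eq_square)
  qed (use assms in auto)
  finally show ?thesis .
qed

text \<open>Every iterated partial derivative is a polynomial times e^q, and the Gaussian decay of
  e^q beats any polynomial growth.\<close>

lemma schwartz_exp_poly:
  fixes q :: "'a::euclidean_space \<Rightarrow> complex"
  assumes q: "poly_fun q" and c: "0 < c" and le: "\<And>x. norm (exp (q x)) \<le> exp (- c * (norm x)\<^sup>2)"
  shows "schwartz (\<lambda>x. exp (q x))"
proof -
  have *: "\<exists>s. poly_fun s \<and> iterated_partial bs (\<lambda>x. exp (q x)) = (\<lambda>x. s x * exp (q x))" for bs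
    using iterated_partial_poly_exp[OF poly_const[of 1] q] by simp
  have "iterated_partial bs (\<lambda>x. exp (q x)) differentiable_on UNIV" for bs
    using *[of bs] poly_exp_has_derivative[OF _ q]
    by (metis differentiableI differentiable_on_def)
  moreover have "\<exists>C. \<forall>x. norm x ^ N * norm (iterated_partial bs (\<lambda>x. exp (q x)) x) \<le> C" for bs N
  proof -
    obtain s where s: "poly_fun s" "iterated_partial bs (\<lambda>x. exp (q x)) = (\<lambda>x. s x * exp (q x))"
      using * by blast
    obtain C m where C: "0 \<le> C" "\<And>x. norm (s x) \<le> C * (1 + norm x) ^ m"
      using poly_fun_growth[OF s(1)] by blast
    have "norm x ^ N * norm (s x * exp (q x)) \<le> C * (2 ^ (m + N) * (1 + fact (m + N) / c ^ (m + N)))"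
      for x
    proof -
      have "norm x ^ N * (norm (s x) * norm (exp (q x)))
          \<le> (1 + norm x) ^ N * (C * (1 + norm x) ^ m * exp (- c * (norm x)\<^sup>2))"
        using C le by (intro mult_mono power_mono) auto
      also have "\<dots> = C * ((1 + norm x) ^ (m + N) * exp (- c * (norm x)\<^sup>2))"
        by (simp add: power_add)
      also have "\<dots> \<le> C * (2 ^ (m + N) * (1 + fact (m + N) / c ^ (m + N)))"
        by (intro mult_left_mono power_times_exp_le C c norm_ge_zero)
      finally show ?thesis by (simp add: norm_mult)
    qed
    then show ?thesis using s(2) by auto
  qed
  ultimately show ?thesis unfolding schwartz_def by blast
qed

lemma schwartz_modulated_gaussian:
  fixes a :: "'a::euclidean_space \<Rightarrow> real"
  assumes a: "\<And>b. b \<in> Basis \<Longrightarrow> 0 < a b"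
  shows "schwartz (\<lambda>x. cis (2 * pi * (z \<bullet> x)) * gaussian a x)"
proof -
  \<comment> \<open>The complex exponent of the modulated Gaussian; squares are written as products
    to match the rules of \<open>poly_fun\<close>.\<close>
  define q where "q x = \<i> * (2 * pi) * of_real (x \<bullet> z)
    + (\<Sum>b\<in>Basis. - pi * (a b)\<^sup>2 * (complex_of_real (x \<bullet> b) * of_real (x \<bullet> b)))" for x
  have "poly_fun q"
    unfolding q_def by (intro poly_fun.intros poly_fun_sum) auto
  have eq: "exp (q x) = cis (2 * pi * (z \<bullet> x)) * gaussian a x" for x
    by (simp add: q_def exp_add gaussian_def cis_conv_exp inner_commute[of z] exp_of_real[symmetric]
        sum_distrib_left power_mult_distrib power2_eq_square sum_negf mult_ac
        exp_diff exp_minus divide_inverse)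
  \<comment> \<open>The smallest weight turns the anisotropic decay into an isotropic Gaussian
    bound.\<close>
  define m where "m = Min (a ` Basis)"
  have m: "0 < m" "\<And>b. b \<in> Basis \<Longrightarrow> m \<le> a b"
    using a by (auto simp: m_def)
  have "norm (exp (q x)) \<le> exp (- (pi * m\<^sup>2) * (norm x)\<^sup>2)" for x
  proof -
    have "m\<^sup>2 * (norm x)\<^sup>2 = (\<Sum>b\<in>Basis. (m * (x \<bullet> b))\<^sup>2)"
      unfolding power2_norm_eq_inner euclidean_inner[of x x]
      by (simp add: sum_distrib_left power2_eq_square mult_ac)
    also have "\<dots> \<le> (\<Sum>b\<in>Basis. (a b * (x \<bullet> b))\<^sup>2)"
      using m by (intro sum_mono) (auto simp: power_mult_distrib intro!: mult_right_mono power_mono)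
    finally show ?thesis
      using gaussian_pos[of a x] by (simp add: eq norm_mult gaussian_def)
  qed
  moreover have "0 < pi * m\<^sup>2" using m(1) by simp
  ultimately have "schwartz (\<lambda>x. exp (q x))"
    using schwartz_exp_poly[OF \<open>poly_fun q\<close>] by blast
  then show ?thesis unfolding eq .
qed

section \<open>Oscillation of Brownian paths\<close>

lemma brownian_increment_second_moment:
  assumes B: "standard_brownian_motion M B" and st: "s \<in> {0..1}" "t \<in> {0..1}"
  shows "(\<integral>\<^sup>+\<omega>. ennreal ((B s \<omega> - B t \<omega>)\<^sup>2) \<partial>M) = ennreal \<bar>s - t\<bar>"
proof -
  have *: "(\<integral>\<^sup>+\<omega>. ennreal ((B t \<omega> - B s \<omega>)\<^sup>2) \<partial>M) = ennreal (t - s)"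
    if "0 \<le> s" "s < t" "t \<le> 1" for s t
  proof -
    let ?N = "normal_density 0 (sqrt (t - s))"
    have "distributed M lborel (\<lambda>\<omega>. B t \<omega> - B s \<omega>) ?N"
      using B that by (auto simp: standard_brownian_motion_def)
    then have "(\<integral>\<^sup>+\<omega>. ennreal ((B t \<omega> - B s \<omega>)\<^sup>2) \<partial>M) = (\<integral>\<^sup>+x. ?N x * ennreal (x\<^sup>2) \<partial>lborel)"
      by (subst distributed_nn_integral[where X = "\<lambda>\<omega>. B t \<omega> - B s \<omega>"]) auto
    also have "\<dots> = (\<integral>\<^sup>+x. ennreal (?N x * x\<^sup>2) \<partial>lborel)"
      by (simp add: ennreal_mult)
    also have "\<dots> = ennreal (t - s)"
    proof (rule nn_integral_eq_integral[THEN trans])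
      have "has_bochner_integral lborel (\<lambda>x. ?N x * x\<^sup>2) (t - s)"
        using normal_moment_even[of "sqrt (t - s)" 0 1] that
        by (simp add: fact_numeral power_divide diff_divide_distrib flip: numeral_2_eq_2)
      then show "integrable lborel (\<lambda>x. ?N x * x\<^sup>2)"
        and "ennreal (LINT x|lborel. ?N x * x\<^sup>2) = ennreal (t - s)"
        by (auto simp: has_bochner_integral_iff)
    qed simp
    finally show ?thesis .
  qed
  \<comment> \<open>Increments are prescribed only for increasing times; the reverse order follows
    from the symmetry of the square, and equal times give 0.\<close>
  consider "s < t" | "s = t" | "t < s" by linarith
  then show ?thesis
    using *[of s t] *[of t s] st by cases (auto simp: power2_commute[of "B s _"])
qed

text \<open>Brownian motion is only assumed measurable at each fixed time; joint measurability comes from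
  approximating the time by \<open>\<lfloor>n t\<rfloor> / n\<close>.\<close>

lemma brownian_motion_jointly_measurable:
  assumes B: "standard_brownian_motion M B"
  obtains Y where "(\<lambda>(t, \<omega>). Y t \<omega>) \<in> borel_measurable (lborel \<Otimes>\<^sub>M M)"
    and "\<And>\<omega> t. continuous_on {0..1} (\<lambda>t. B t \<omega>) \<Longrightarrow> t \<in> {0..1} \<Longrightarrow> Y t \<omega> = (B t \<omega> :: real)"
proof
  \<comment> \<open>Clamping keeps the time in [0,1], where \<open>B\<close> is measurable in the
    sample point; for \<open>n = 0\<close> division by zero yields time 0.\<close>
  define c :: "nat \<Rightarrow> int \<Rightarrow> real" where "c n j = max 0 (min 1 (of_int j / n))" for n j
  define Y where "Y t \<omega> = lim (\<lambda>n. B (c n \<lfloor>real n * t\<rfloor>) \<omega>)" for t \<omega>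
  have c: "c n j \<in> {0..1}" for n j
    by (auto simp: c_def)
  have [measurable]: "B (c n j) \<in> borel_measurable M" for n j
    using B c by (auto simp: standard_brownian_motion_def)
  \<comment> \<open>The rounded time takes countably many values, so the composite is a countable
    gluing of measurable pieces.\<close>
  have "(\<lambda>p. B (c n \<lfloor>real n * fst p\<rfloor>) (snd p)) \<in> borel_measurable (lborel \<Otimes>\<^sub>M M)" for n
    using measurable_compose_countable[where f = "\<lambda>j p. B (c n j) (snd p)"
        and g = "\<lambda>p. \<lfloor>real n * fst p\<rfloor>" and M = "lborel \<Otimes>\<^sub>M M" and N = borel]
    by simp
  then show "(\<lambda>(t, \<omega>). Y t \<omega>) \<in> borel_measurable (lborel \<Otimes>\<^sub>M M)"
    unfolding Y_def case_prod_beta by (rule borel_measurable_lim_metric)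
  fix \<omega> t
  assume cont: "continuous_on {0..1} (\<lambda>t. B t \<omega>)" and t: "t \<in> {0..1::real}"
  have "(\<lambda>n. of_int \<lfloor>real n * t\<rfloor> / real n) \<longlonglongrightarrow> t"
  proof (rule tendsto_sandwich)
    show "\<forall>\<^sub>F n in sequentially. t - 1 / real n \<le> of_int \<lfloor>real n * t\<rfloor> / real n"
      using eventually_gt_at_top[of 0]
    proof eventually_elim
      case (elim n)
      have "(real n * t - 1) / real n \<le> of_int \<lfloor>real n * t\<rfloor> / real n"
        by (intro divide_right_mono) linarith+
      then show ?case using elim by (simp add: diff_divide_distrib)
    qed
    show "\<forall>\<^sub>F n in sequentially. of_int \<lfloor>real n * t\<rfloor> / real n \<le> t"
      using eventually_gt_at_top[of 0]
      by eventually_elim (simp add: divide_le_eq mult.commute)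
    show "(\<lambda>n. t - 1 / real n) \<longlonglongrightarrow> t"
      using tendsto_diff[OF tendsto_const lim_1_over_n] by simp
  qed simp
  then have "(\<lambda>n. c n \<lfloor>real n * t\<rfloor>) \<longlonglongrightarrow> max 0 (min 1 t)"
    unfolding c_def by (intro tendsto_intros)
  then have "(\<lambda>n. c n \<lfloor>real n * t\<rfloor>) \<longlonglongrightarrow> t"
    using t by simp
  then have "(\<lambda>n. B (c n \<lfloor>real n * t\<rfloor>) \<omega>) \<longlonglongrightarrow> B t \<omega>"
    by (rule continuous_on_tendsto_compose[OF cont _ t always_eventually[OF allI[OF c]]])
  then show "Y t \<omega> = B t \<omega>"
    unfolding Y_def by (rule limI)
qed

section \<open>Mean square oscillation at scale r\<close>

definition near_diagonal :: "real \<Rightarrow> (real \<times> real) set" where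
  "near_diagonal r = {(a, b). a \<in> {0..1} \<and> b \<in> {0..1} \<and> \<bar>a - b\<bar> \<le> r}"

text \<open>An unnormalised mean square increment. For Brownian motion its natural size is r^2: one
  factor r from the area of the strip and one from the variance of an increment over time at most
  r.\<close>

definition oscillation :: "(real \<Rightarrow> real) \<Rightarrow> real \<Rightarrow> ennreal" where
  "oscillation w r =
     (\<integral>\<^sup>+p\<in>near_diagonal r. ennreal ((w (fst p) - w (snd p))\<^sup>2) \<partial>(lborel \<Otimes>\<^sub>M lborel))"

lemma sets_near_diagonal [measurable]: "near_diagonal r \<in> sets (borel \<Otimes>\<^sub>M borel)"
proof -
  have "near_diagonal r = {p \<in> space (borel \<Otimes>\<^sub>M borel).
      fst p \<in> {0..1} \<and> snd p \<in> {0..1} \<and> \<bar>fst p - snd p\<bar> \<le> r}"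
    by (auto simp: near_diagonal_def space_pair_measure)
  also have "\<dots> \<in> sets (borel \<Otimes>\<^sub>M borel)"
    by measurable
  finally show ?thesis .
qed

text \<open>Each vertical slice over a point of [0,1] is an interval of length at most 2r.
  Truncation to [0,1] leaves length at least r because \<open>r \<le> 1\<close>.\<close>

lemma
  assumes r: "0 < r" "r \<le> 1"
  shows emeasure_near_diagonal_le: "emeasure (lborel \<Otimes>\<^sub>M lborel) (near_diagonal r) \<le> ennreal (2 * r)"
    and emeasure_near_diagonal_ge: "ennreal r \<le> emeasure (lborel \<Otimes>\<^sub>M lborel) (near_diagonal r)"
proof -
  have slice: "emeasure lborel (Pair a -` near_diagonal r)
      = ennreal (min 1 (a + r) - max 0 (a - r)) * indicator {0..1} a" for a
  proof (cases "a \<in> {0..1}")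
    case True
    then have "Pair a -` near_diagonal r = {max 0 (a - r)..min 1 (a + r)}"
      by (auto simp: near_diagonal_def abs_le_iff)
    then show ?thesis
      using True r by (subst \<open>_ = _\<close>, subst emeasure_lborel_Icc) auto
  next
    case False
    then have "Pair a -` near_diagonal r = {}"
      by (auto simp: near_diagonal_def)
    then show ?thesis using False by simp
  qed
  have eq: "emeasure (lborel \<Otimes>\<^sub>M lborel) (near_diagonal r)
      = (\<integral>\<^sup>+a. ennreal (min 1 (a + r) - max 0 (a - r)) * indicator {0..1} a \<partial>lborel)"
    by (subst lborel.emeasure_pair_measure_alt) (auto simp: slice)
  have "(\<integral>\<^sup>+a. ennreal (min 1 (a + r) - max 0 (a - r)) * indicator {0..1} a \<partial>lborel)
      \<le> (\<integral>\<^sup>+a. ennreal (2 * r) * indicator {0..1::real} a \<partial>lborel)"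
    by (intro nn_integral_mono mult_right_mono ennreal_leI) auto
  then show "emeasure (lborel \<Otimes>\<^sub>M lborel) (near_diagonal r) \<le> ennreal (2 * r)"
    unfolding eq by (simp add: nn_integral_cmult_indicator)
  have "(\<integral>\<^sup>+a. ennreal r * indicator {0..1::real} a \<partial>lborel)
      \<le> (\<integral>\<^sup>+a. ennreal (min 1 (a + r) - max 0 (a - r)) * indicator {0..1} a \<partial>lborel)"
    using r by (intro nn_integral_mono) (auto simp: indicator_def intro!: ennreal_leI)
  then show "ennreal r \<le> emeasure (lborel \<Otimes>\<^sub>M lborel) (near_diagonal r)"
    unfolding eq by (simp add: nn_integral_cmult_indicator)
qed

lemma oscillation_cong:
  assumes "\<And>a. a \<in> {0..1} \<Longrightarrow> v a = w a"
  shows "oscillation v r = oscillation w r"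
  unfolding oscillation_def
  by (intro nn_integral_cong) (auto simp: indicator_def near_diagonal_def assms)

text \<open>The expected oscillation at scale r is at most 2 r^2. Hence the normalised oscillations
  have bounded mean, Fatou's lemma makes their liminf almost surely finite, and a finite liminf is a
  bound along infinitely many scales.\<close>

lemma frequently_oscillation_bounded:
  fixes W :: "'k::finite \<Rightarrow> real \<Rightarrow> 'w \<Rightarrow> real" and r :: "nat \<Rightarrow> real"
  assumes W: "\<And>i. standard_brownian_motion M (W i)" and r: "\<And>n. 0 < r n" "\<And>n. r n \<le> 1"
  shows "AE \<omega> in M. (\<forall>i. continuous_on {0..1} (\<lambda>t. W i t \<omega>)) \<and>
    (\<exists>K>0. \<exists>\<^sub>F n in sequentially. \<forall>i. oscillation (\<lambda>t. W i t \<omega>) (r n) \<le> ennreal (K * (r n)\<^sup>2))"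
proof -
  interpret prob_space M
    using W by (auto simp: standard_brownian_motion_def)
  interpret P: pair_sigma_finite "lborel \<Otimes>\<^sub>M lborel :: (real \<times> real) measure" M
    by (intro pair_sigma_finite.intro sigma_finite_pair_measure) unfold_locales
  have cont: "AE \<omega> in M. \<forall>i. continuous_on {0..1} (\<lambda>t. W i t \<omega>)"
    using W by (auto simp: standard_brownian_motion_def AE_all_countable)
  \<comment> \<open>The versions \<open>Y i\<close> are jointly measurable and agree with
    \<open>W i\<close> on continuous paths, so Tonelli can be applied to them.\<close>
  have "\<forall>i. \<exists>Y. (\<lambda>(t, \<omega>). Y t \<omega>) \<in> borel_measurable (lborel \<Otimes>\<^sub>M M) \<and>
      (\<forall>\<omega> t. continuous_on {0..1} (\<lambda>t. W i t \<omega>) \<longrightarrow> t \<in> {0..1} \<longrightarrow> Y t \<omega> = W i t \<omega>)"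
    using brownian_motion_jointly_measurable[OF W] by metis
  then obtain Y where Ym: "\<And>i. (\<lambda>(t, \<omega>). Y i t \<omega>) \<in> borel_measurable (lborel \<Otimes>\<^sub>M M)"
    and Y: "\<And>i \<omega> t. continuous_on {0..1} (\<lambda>t. W i t \<omega>) \<Longrightarrow> t \<in> {0..1} \<Longrightarrow> Y i t \<omega> = W i t \<omega>"
    by metis
  have [measurable]: "(\<lambda>x. Y i (f x) (g x)) \<in> borel_measurable N"
    if "f \<in> borel_measurable N" "g \<in> measurable N M" for i f g and N :: "'c measure"
  proof -
    have "(\<lambda>x. (f x, g x)) \<in> measurable N (lborel \<Otimes>\<^sub>M M)"
      using that by (intro measurable_Pair) simp_all
    from measurable_compose[OF this Ym] show ?thesis by simp
  qed
  \<comment> \<open>Tonelli moves the expectation inside, where the second moment of an increment is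
    at most \<open>r n\<close>; the area of the strip supplies the other factor 2
    \<open>r n\<close>.\<close>
  have expect: "(\<integral>\<^sup>+\<omega>. oscillation (\<lambda>t. Y i t \<omega>) (r n) \<partial>M) \<le> ennreal (2 * (r n)\<^sup>2)" for i n
  proof -
    have "(\<integral>\<^sup>+\<omega>. oscillation (\<lambda>t. Y i t \<omega>) (r n) \<partial>M)
        = (\<integral>\<^sup>+p. (\<integral>\<^sup>+\<omega>. ennreal ((Y i (fst p) \<omega> - Y i (snd p) \<omega>)\<^sup>2) * indicator (near_diagonal (r n)) p \<partial>M)
            \<partial>(lborel \<Otimes>\<^sub>M lborel))"
      unfolding oscillation_def by (rule P.Fubini') measurable
    also have "\<dots> \<le> (\<integral>\<^sup>+p. ennreal (r n) * indicator (near_diagonal (r n)) p \<partial>(lborel \<Otimes>\<^sub>M lborel))"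
    proof (rule nn_integral_mono)
      fix p :: "real \<times> real"
      show "(\<integral>\<^sup>+\<omega>. ennreal ((Y i (fst p) \<omega> - Y i (snd p) \<omega>)\<^sup>2) * indicator (near_diagonal (r n)) p \<partial>M)
        \<le> ennreal (r n) * indicator (near_diagonal (r n)) p"
      proof (cases "p \<in> near_diagonal (r n)")
        case True
        then have p: "fst p \<in> {0..1}" "snd p \<in> {0..1}" "\<bar>fst p - snd p\<bar> \<le> r n"
          by (auto simp: near_diagonal_def)
        have "(\<integral>\<^sup>+\<omega>. ennreal ((Y i (fst p) \<omega> - Y i (snd p) \<omega>)\<^sup>2) \<partial>M)
            = (\<integral>\<^sup>+\<omega>. ennreal ((W i (fst p) \<omega> - W i (snd p) \<omega>)\<^sup>2) \<partial>M)"
        \<comment> \<open>Both processes agree at the two given times on the almost sure event of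
          continuous paths.\<close>
        proof (rule nn_integral_cong_AE)
          show "AE \<omega> in M. ennreal ((Y i (fst p) \<omega> - Y i (snd p) \<omega>)\<^sup>2)
              = ennreal ((W i (fst p) \<omega> - W i (snd p) \<omega>)\<^sup>2)"
            using cont by eventually_elim (simp add: Y p[simplified])
        qed
        also have "\<dots> \<le> ennreal (r n)"
          using p by (simp add: brownian_increment_second_moment[OF W] ennreal_leI)
        finally show ?thesis using True by simp
      qed simp
    qed
    also have "\<dots> = ennreal (r n) * emeasure (lborel \<Otimes>\<^sub>M lborel) (near_diagonal (r n))"
      by (rule nn_integral_cmult_indicator) simp
    also have "\<dots> \<le> ennreal (r n) * ennreal (2 * r n)"
      by (intro mult_left_mono emeasure_near_diagonal_le r) simp
    also have "\<dots> = ennreal (2 * (r n)\<^sup>2)"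
      using r(1)[of n] by (simp add: power2_eq_square mult_ac flip: ennreal_mult)
    finally show ?thesis .
  qed
  have [measurable]: "(\<lambda>\<omega>. oscillation (\<lambda>t. Y i t \<omega>) (r n)) \<in> borel_measurable M" for i n
    unfolding oscillation_def by measurable
  \<comment> \<open>Summing over all coordinates makes one good scale serve every \<open>i\<close>
    simultaneously; bounding each coordinate separately could give different scales.\<close>
  define Z where "Z n \<omega> = (\<Sum>i\<in>UNIV. oscillation (\<lambda>t. Y i t \<omega>) (r n)) * ennreal (1 / (r n)\<^sup>2)" for n \<omega>
  have [measurable]: "Z n \<in> borel_measurable M" for n
    unfolding Z_def by measurable
  have EZ: "(\<integral>\<^sup>+\<omega>. Z n \<omega> \<partial>M) \<le> ennreal (2 * CARD('k))" for n
  proof -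
    have "(\<integral>\<^sup>+\<omega>. Z n \<omega> \<partial>M) = (\<Sum>i\<in>UNIV. (\<integral>\<^sup>+\<omega>. oscillation (\<lambda>t. Y i t \<omega>) (r n) \<partial>M)) * ennreal (1 / (r n)\<^sup>2)"
      unfolding Z_def by (simp add: nn_integral_multc nn_integral_sum)
    also have "\<dots> \<le> (\<Sum>i\<in>(UNIV::'k set). ennreal (2 * (r n)\<^sup>2)) * ennreal (1 / (r n)\<^sup>2)"
      by (intro mult_right_mono sum_mono expect) simp
    also have "\<dots> = ennreal (2 * CARD('k))"
      using r(1)[of n] by (simp add: sum_nonneg ennreal_mult[symmetric] ennreal_of_nat_eq_real_of_nat)
    finally show ?thesis .
  qed
  have "(\<integral>\<^sup>+\<omega>. liminf (\<lambda>n. Z n \<omega>) \<partial>M) \<le> liminf (\<lambda>n. \<integral>\<^sup>+\<omega>. Z n \<omega> \<partial>M)"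
    by (rule nn_integral_liminf) simp
  also have "\<dots> \<le> ennreal (2 * CARD('k))"
    using Liminf_le[of sequentially "\<lambda>n. \<integral>\<^sup>+\<omega>. Z n \<omega> \<partial>M"] EZ by (simp add: always_eventually)
  finally have "(\<integral>\<^sup>+\<omega>. liminf (\<lambda>n. Z n \<omega>) \<partial>M) \<noteq> \<infinity>"
    by (auto simp: top_unique)
  then have "AE \<omega> in M. liminf (\<lambda>n. Z n \<omega>) \<noteq> \<infinity>"
    by (intro nn_integral_PInf_AE) auto
  then show ?thesis
    using cont
  proof eventually_elim
    case (elim \<omega>)
    \<comment> \<open>The added 1 puts \<open>K\<close> strictly above the liminf, so
      \<open>Z n\<close> cannot eventually stay above \<open>K\<close>; it also makes
      \<open>K\<close> positive.\<close>
    define K where "K = enn2real (liminf (\<lambda>n. Z n \<omega>)) + 1"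
    have "K > 0"
      using enn2real_nonneg[of "liminf (\<lambda>n. Z n \<omega>)"] unfolding K_def by linarith
    have "liminf (\<lambda>n. Z n \<omega>) = ennreal (K - 1)"
      using elim(1) by (simp add: K_def less_top)
    then have K: "K > 0" "liminf (\<lambda>n. Z n \<omega>) < ennreal K"
      using \<open>K > 0\<close> by (simp_all add: ennreal_lessI)
    have "\<exists>\<^sub>F n in sequentially. Z n \<omega> \<le> ennreal K"
    proof (rule ccontr)
      assume "\<not> ?thesis"
      then have "\<forall>\<^sub>F n in sequentially. ennreal K \<le> Z n \<omega>"
        unfolding not_frequently by eventually_elim simp
      from Liminf_bounded[OF this] K(2) show False by (simp add: leD)
    qed
    then have "\<exists>\<^sub>F n in sequentially. \<forall>i. oscillation (\<lambda>t. W i t \<omega>) (r n) \<le> ennreal (K * (r n)\<^sup>2)"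
    proof (rule frequently_elim1, intro allI)
      fix n i
      assume "Z n \<omega> \<le> ennreal K"
      have "oscillation (\<lambda>t. W i t \<omega>) (r n) = oscillation (\<lambda>t. Y i t \<omega>) (r n)"
        using elim(2) by (intro oscillation_cong) (simp add: Y)
      also have "\<dots> \<le> (\<Sum>i\<in>UNIV. oscillation (\<lambda>t. Y i t \<omega>) (r n))"
        by (rule member_le_sum) auto
      also have "\<dots> = Z n \<omega> * ennreal ((r n)\<^sup>2)"
        using r(1)[of n] by (simp add: Z_def mult.assoc flip: ennreal_mult)
      also have "\<dots> \<le> ennreal K * ennreal ((r n)\<^sup>2)"
        using \<open>Z n \<omega> \<le> ennreal K\<close> by (rule mult_right_mono) simp
      finally show "oscillation (\<lambda>t. W i t \<omega>) (r n) \<le> ennreal (K * (r n)\<^sup>2)"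
        using K(1) by (simp add: ennreal_mult)
    qed
    then show ?case using elim(2) K(1) by blast
  qed
qed

text \<open>On the strip the time part of the exponent costs at most e^(-2 pi), and e^(-x) >= 1 - x
  handles the spatial part. The strip contributes at least e^(-2 pi) r, and the assumption on
  \<open>L\<close> and \<open>K\<close> limits the loss from the oscillation to half of
  this.\<close>

lemma gaussian_mass_near_diagonal:
  fixes w :: "real \<Rightarrow> real"
  assumes w: "continuous_on {0..1} w" and r: "0 < r" "r \<le> 1" and L: "0 < L" "4 * pi * L * K \<le> 1"
    and K: "oscillation w r \<le> ennreal (K * r\<^sup>2)"
  shows "ennreal (exp (- 2 * pi) * r / 2) \<le>
    (\<integral>\<^sup>+a\<in>{0..1}. (\<integral>\<^sup>+b\<in>{0..1}. ennreal (exp (- 2 * pi * (((a - b) / r)\<^sup>2 + L * (w a - w b)\<^sup>2 / r))) \<partial>lborel) \<partial>lborel)"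
    (is "_ \<le> ?J")
proof -
  \<comment> \<open>Cutting the path off outside [0,1] yields a Borel function on the whole line
    without changing the values that matter.\<close>
  define v where "v a = indicator {0..1} a * w a" for a
  have [measurable]: "v \<in> borel_measurable borel"
    using borel_measurable_continuous_on_indicator[OF _ w] by (simp add: v_def[abs_def])
  have v: "v a = w a" if "a \<in> {0..1}" for a
    using that by (simp add: v_def)
  define F where "F p = exp (- 2 * pi * (((fst p - snd p) / r)\<^sup>2 + L * (v (fst p) - v (snd p))\<^sup>2 / r))" for p
  have [measurable]: "F \<in> borel_measurable (borel \<Otimes>\<^sub>M borel)"
    unfolding F_def by measurable
  let ?L = "lborel \<Otimes>\<^sub>M lborel :: (real \<times> real) measure"
  let ?D = "near_diagonal r"
  let ?e = "exp (- 2 * pi)"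
  \<comment> \<open>The loss is added on the right instead of being subtracted on the left, so that
    the integration takes place in nonnegative quantities.\<close>
  have pt: "?e \<le> F p + ?e * (2 * pi * L / r) * (v (fst p) - v (snd p))\<^sup>2" if "p \<in> ?D" for p
  proof -
    define y where "y = (v (fst p) - v (snd p))\<^sup>2"
    have "((fst p - snd p) / r)\<^sup>2 \<le> 1"
      using that r by (auto simp: near_diagonal_def abs_square_le_1)
    then have "?e * exp (- (2 * pi * L / r) * y) \<le> F p"
      by (simp add: F_def y_def distrib_left mult_ac flip: exp_add)
    moreover have "1 - (2 * pi * L / r) * y \<le> exp (- (2 * pi * L / r) * y)"
      using exp_ge_add_one_self[of "- (2 * pi * L / r) * y"] by simp
    then have "?e * (1 - (2 * pi * L / r) * y) \<le> ?e * exp (- (2 * pi * L / r) * y)"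
      by (rule mult_left_mono) simp
    ultimately show ?thesis
      unfolding y_def[symmetric] by (simp add: algebra_simps)
  qed
  have "ennreal (?e * r) \<le> ennreal ?e * emeasure ?L ?D"
    using emeasure_near_diagonal_ge[OF r] r by (simp add: ennreal_mult mult_left_mono)
  also have "\<dots> = (\<integral>\<^sup>+p\<in>?D. ennreal ?e \<partial>?L)"
    by (rule nn_integral_cmult_indicator[symmetric]) simp
  also have "\<dots> \<le> (\<integral>\<^sup>+p. ennreal (F p) * indicator ?D p
      + ennreal (?e * (2 * pi * L / r)) * (ennreal ((v (fst p) - v (snd p))\<^sup>2) * indicator ?D p) \<partial>?L)"
    using pt L r by (intro nn_integral_mono)
      (auto simp: indicator_def F_def ennreal_mult[symmetric] ennreal_plus[symmetric] simp del: ennreal_plus intro!: ennreal_leI)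
  also have "\<dots> = (\<integral>\<^sup>+p\<in>?D. ennreal (F p) \<partial>?L) + ennreal (?e * (2 * pi * L / r)) * oscillation v r"
    unfolding oscillation_def by (simp add: nn_integral_add nn_integral_cmult)
  also have "oscillation v r = oscillation w r"
    by (rule oscillation_cong) (rule v)
  also have "ennreal (?e * (2 * pi * L / r)) * oscillation w r
      \<le> ennreal (?e * (2 * pi * L / r)) * ennreal (K * r\<^sup>2)"
    by (rule mult_left_mono[OF K]) simp
  also have "\<dots> = ennreal (?e * (2 * pi * L / r) * (K * r\<^sup>2))"
    using L r by (intro ennreal_mult'[symmetric]) simp
  also have "\<dots> \<le> ennreal (?e * r / 2)"
  proof (rule ennreal_leI)
    have "?e * (2 * pi * L / r) * (K * r\<^sup>2) = (?e * r / 2) * (4 * pi * L * K)"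
      using r by (simp add: power2_eq_square)
    also have "\<dots> \<le> (?e * r / 2) * 1"
      using r by (intro mult_left_mono L) auto
    finally show "?e * (2 * pi * L / r) * (K * r\<^sup>2) \<le> ?e * r / 2" by simp
  qed
  \<comment> \<open>The main term is split into two halves so that the finite loss can be cancelled
    from both sides in \<open>ennreal\<close>.\<close>
  finally have "ennreal (?e * r / 2) + ennreal (?e * r / 2) \<le> (\<integral>\<^sup>+p\<in>?D. ennreal (F p) \<partial>?L) + ennreal (?e * r / 2)"
    using r by (simp add: add_left_mono mult.commute flip: ennreal_plus)
  then have "ennreal (?e * r / 2) \<le> (\<integral>\<^sup>+p\<in>?D. ennreal (F p) \<partial>?L)"
    by (simp add: ennreal_add_left_cancel_le add.commute)
  also have "\<dots> \<le> (\<integral>\<^sup>+p. ennreal (F p) * indicator {0..1} (snd p) * indicator {0..1} (fst p) \<partial>?L)"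
    by (intro nn_integral_mono) (auto simp: indicator_def near_diagonal_def)
  also have "\<dots> = (\<integral>\<^sup>+a. (\<integral>\<^sup>+b. ennreal (F (a, b)) * indicator {0..1} b * indicator {0..1} a \<partial>lborel) \<partial>lborel)"
    by (subst lborel.nn_integral_fst[symmetric]) simp_all
  also have "\<dots> = ?J"
    by (intro nn_integral_cong) (auto simp: indicator_def F_def v intro!: nn_integral_cong)
  finally show ?thesis .
qed

section \<open>Gaussian energy of the surface measure\<close>

lemma nn_integral_prod_cart:
  fixes f :: "'k::finite \<Rightarrow> real \<Rightarrow> ennreal"
  assumes [measurable]: "\<And>i. f i \<in> borel_measurable borel"
  shows "(\<integral>\<^sup>+x. (\<Prod>i\<in>UNIV. f i (x $ i)) \<partial>(lborel :: (real ^ 'k) measure)) = (\<Prod>i\<in>UNIV. \<integral>\<^sup>+x. f i x \<partial>lborel)"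
proof -
  \<comment> \<open>Recovers the coordinate index from a basis vector, to pass between products over
    \<open>Basis\<close> and over the index type.\<close>
  define j :: "real ^ 'k \<Rightarrow> 'k" where "j b = (THE i. b = axis i 1)" for b
  have j: "j (axis i 1) = i" for i
    unfolding j_def by (rule the_equality) (auto simp: axis_eq_axis)
  have reindex: "(\<Prod>b\<in>(Basis :: (real ^ 'k) set). h b) = (\<Prod>i\<in>UNIV. h (axis i 1))" for h :: "_ \<Rightarrow> ennreal"
    by (rule prod.reindex_cong[of "\<lambda>i. axis i 1"]) (auto simp: inj_on_def axis_eq_axis Basis_vec_def)
  have "(\<integral>\<^sup>+x. (\<Prod>b\<in>Basis. f (j b) (x \<bullet> b)) \<partial>(lborel :: (real ^ 'k) measure))
      = (\<Prod>b\<in>(Basis :: (real ^ 'k) set). \<integral>\<^sup>+x. f (j b) x \<partial>lborel)"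
    by (rule nn_integral_lborel_prod) auto
  then show ?thesis
    by (simp add: reindex j inner_axis)
qed

lemma indicator_unit_cube:
  "indicator unit_cube t = (\<Prod>i\<in>UNIV. indicator {0..1} (t $ i) :: ennreal)"
  by (auto simp: unit_cube_def indicator_def)

lemma emeasure_unit_cube: "emeasure lborel (unit_cube :: (real ^ 'k::finite) set) = 1"
proof -
  have "emeasure lborel (unit_cube :: (real ^ 'k) set) = (\<integral>\<^sup>+x. indicator unit_cube (x :: real ^ 'k) \<partial>lborel)"
    by simp
  also have "\<dots> = 1"
    unfolding indicator_unit_cube by (subst nn_integral_prod_cart) auto
  finally show ?thesis .
qed

lemma measurable_graph:
  assumes X: "continuous_on unit_cube X"
  shows "(\<lambda>t. (t, X t)) \<in> borel_measurable (restrict_space lborel unit_cube)"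
  using borel_measurable_continuous_on_restrict[OF continuous_on_Pair[OF continuous_on_id X]]
  by (simp add: measurable_cong_sets[OF sets_restrict_space_cong[OF sets_lborel] refl])

lemma prob_space_surface_measure:
  fixes X :: "real ^ 'k::finite \<Rightarrow> real"
  assumes X: "continuous_on unit_cube X"
  shows "prob_space (surface_measure X)"
  using emeasure_surface_measure[OF X, of UNIV] emeasure_unit_cube
  by (intro prob_spaceI) (simp add: surface_measure_def)

lemma nn_integral_surface_measure:
  fixes X :: "real ^ 'k::finite \<Rightarrow> real"
  assumes X: "continuous_on unit_cube X" and g: "g \<in> borel_measurable borel"
  shows "(\<integral>\<^sup>+x. g x \<partial>surface_measure X) = (\<integral>\<^sup>+t\<in>unit_cube. g (t, X t) \<partial>lborel)"
  unfolding surface_measure_def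
  by (simp add: nn_integral_distr[OF measurable_graph[OF X]] g nn_integral_restrict_space)

text \<open>On basis vectors, \<open>snd b = 0\<close> singles out the k time directions; the
  remaining one is the direction of the values of the sheet.\<close>

definition weights :: "real \<Rightarrow> real \<Rightarrow> (real ^ 'k::finite) \<times> real \<Rightarrow> real" where
  "weights r s b = (if snd b = 0 then r else s)"

lemma weights_pos: "0 < r \<Longrightarrow> 0 < s \<Longrightarrow> 0 < weights r s b"
  by (simp add: weights_def)

lemma gaussian_weights:
  "gaussian (weights r s) (x, y) = exp (- pi * ((\<Sum>i\<in>UNIV. (r * x $ i)\<^sup>2) + (s * y)\<^sup>2))"
proof -
  have "(\<Sum>u\<in>Basis. (r * (x \<bullet> u))\<^sup>2) = (\<Sum>i\<in>UNIV. (r * x $ i)\<^sup>2)"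
    by (rule sum.reindex_cong[of "\<lambda>i. axis i 1"])
      (auto simp: inj_on_def axis_eq_axis Basis_vec_def inner_axis)
  then show ?thesis
    unfolding gaussian_def Basis_prod_def
    by (subst sum.union_disjoint) (auto simp: sum.reindex inj_on_def weights_def)
qed

lemma prod_inverse_weights:
  "(\<Prod>b\<in>(Basis :: ((real ^ 'k::finite) \<times> real) set). inverse (weights r s b))
    = inverse (r ^ CARD('k) * s)"
proof -
  have "(\<Prod>b\<in>(Basis :: ((real ^ 'k) \<times> real) set). inverse (weights r s b))
      = (\<Prod>u\<in>(Basis :: (real ^ 'k) set). inverse r) * inverse s"
    unfolding Basis_prod_def
    by (subst prod.union_disjoint)
      (auto simp: prod.reindex inj_on_def weights_def)
  then show ?thesis by (simp add: power_inverse)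
qed

text \<open>Passes from the frequency Gaussian to its dual in space, with width r in time and sqrt(r
  / L) in value. This is Brownian scaling.\<close>

lemma inverse_parabolic_weights:
  "(\<lambda>b. inverse (weights r (sqrt (r / L)) b)) = weights (1 / r) (sqrt (L / r))"
  by (simp add: fun_eq_iff weights_def inverse_eq_divide real_sqrt_divide)

text \<open>The mass of the frequency Gaussian, equal to the peak of its transform: r^(-k) from the
  time directions and sqrt(L / r) from the value direction.\<close>

lemma prod_inverse_parabolic_weights:
  assumes "0 < r" "0 < L"
  shows "(\<Prod>b\<in>(Basis :: ((real ^ 'k::finite) \<times> real) set). inverse (weights r (sqrt (r / L)) b))
    = sqrt L * r powr (- (2 * real CARD('k) + 1) / 2)"
proof -
  have "- (2 * real CARD('k) + 1) / 2 = - real CARD('k) + - 1 / 2"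
    by (simp add: field_simps)
  then have "r powr (- (2 * real CARD('k) + 1) / 2) = r powr - real CARD('k) * r powr (- 1 / 2)"
    by (simp only: powr_add)
  then show ?thesis
    using assms unfolding prod_inverse_weights
    by (simp add: powr_minus powr_realpow real_sqrt_divide field_simps powr_half_sqrt)
qed

lemma continuous_on_additive_sheet:
  fixes w :: "'k::finite \<Rightarrow> real \<Rightarrow> real"
  assumes "\<And>i. continuous_on {0..1} (w i)"
  shows "continuous_on unit_cube (additive_sheet w)"
  unfolding additive_sheet_def
  by (intro continuous_on_sum continuous_on_compose2[OF assms])
    (auto simp: unit_cube_def intro: continuous_on_component)

lemma prod_mono_ennreal:
  fixes f g :: "'i \<Rightarrow> ennreal"
  assumes "\<And>i. i \<in> A \<Longrightarrow> f i \<le> g i"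
  shows "prod f A \<le> prod g A"
  using assms by (induction A rule: infinite_finite_induct) (auto intro: mult_mono)

text \<open>The sheet has increments \<open>\<Sum>i. D\<^sub>i\<close> with \<open>(\<Sum>i. D\<^sub>i)\<^sup>2 \<le> k (\<Sum>i. D\<^sub>i\<^sup>2)\<close>, so the Gaussian energy is
  bounded below by a product of one-dimensional energies.\<close>

lemma energy_lower_bound:
  fixes w :: "'k::finite \<Rightarrow> real \<Rightarrow> real" and r L K :: real
  defines "\<mu> \<equiv> surface_measure (additive_sheet w)"
  assumes w: "\<And>i. continuous_on {0..1} (w i)" and r: "0 < r" "r \<le> 1"
    and L: "0 < L" "4 * pi * (CARD('k) * L) * K \<le> 1"
    and K: "\<And>i. oscillation (w i) r \<le> ennreal (K * r\<^sup>2)"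
  shows "ennreal ((exp (- 2 * pi) * r / 2) ^ CARD('k)) \<le>
    (\<integral>\<^sup>+x. (\<integral>\<^sup>+y. ennreal ((gaussian (weights (1 / r) (sqrt (L / r))) (x - y))\<^sup>2) \<partial>\<mu>) \<partial>\<mu>)"
proof -
  define v where "v i a = indicator {0..1} a * w i a" for i a
  have [measurable]: "v i \<in> borel_measurable borel" for i
    using borel_measurable_continuous_on_indicator[OF _ w] by (simp add: v_def[abs_def])
  have v: "v i a = w i a" if "a \<in> {0..1}" for i a
    using that by (simp add: v_def)
  let ?k = "real CARD('k)"
  let ?a = "weights (1 / r) (sqrt (L / r)) :: (real ^ 'k) \<times> real \<Rightarrow> real"
  \<comment> \<open>The factor \<open>?k * L\<close> in place of \<open>L\<close> absorbs the loss
    from the Cauchy-Schwarz inequality over the k summands.\<close>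
  define h where "h i a b = ennreal (exp (- 2 * pi * (((a - b) / r)\<^sup>2 + ?k * L * (v i a - v i b)\<^sup>2 / r)))
    * indicator {0..1} b" for i a b
  define H where "H i a = (\<integral>\<^sup>+b. h i a b \<partial>lborel) * indicator {0..1} a" for i a
  have [measurable]: "(\<lambda>p. h i (fst p) (snd p)) \<in> borel_measurable (borel \<Otimes>\<^sub>M borel)" for i
    unfolding h_def by measurable
  have [measurable]: "h i a \<in> borel_measurable borel" for i a
    unfolding h_def by measurable
  have [measurable]: "H i \<in> borel_measurable borel" for i
    unfolding H_def by measurable
  note X = continuous_on_additive_sheet[OF w]
  \<comment> \<open>Squaring the Gaussian doubles its exponent to -2 pi, as in \<open>h\<close>.
    Outside the cube one indicator factor of the product vanishes.\<close>
  have pt: "(\<Prod>i\<in>UNIV. h i (t $ i) (t' $ i))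
      \<le> ennreal ((gaussian ?a ((t, additive_sheet w t) - (t', additive_sheet w t')))\<^sup>2) * indicator unit_cube t'"
    if t: "t \<in> unit_cube" for t t' :: "real ^ 'k"
  proof (cases "t' \<in> unit_cube")
    case True
    have e: "additive_sheet w t - additive_sheet w t' = (\<Sum>i\<in>UNIV. v i (t $ i) - v i (t' $ i))"
      using t True by (simp add: additive_sheet_def sum_subtractf unit_cube_def v)
    have "(additive_sheet w t - additive_sheet w t')\<^sup>2 \<le> (\<Sum>i\<in>UNIV. (v i (t $ i) - v i (t' $ i))\<^sup>2) * ?k"
      unfolding e by (rule sum_squared_le_sum_of_squares)
    then have "L / r * (additive_sheet w t - additive_sheet w t')\<^sup>2
        \<le> L / r * ((\<Sum>i\<in>UNIV. (v i (t $ i) - v i (t' $ i))\<^sup>2) * ?k)"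
      using L(1) r(1) by (intro mult_left_mono) auto
    moreover have "(\<Sum>i\<in>UNIV. ((t $ i - t' $ i) / r)\<^sup>2 + ?k * L * (v i (t $ i) - v i (t' $ i))\<^sup>2 / r)
        = (\<Sum>i\<in>UNIV. ((t $ i - t' $ i) / r)\<^sup>2) + L / r * ((\<Sum>i\<in>UNIV. (v i (t $ i) - v i (t' $ i))\<^sup>2) * ?k)"
      by (simp add: sum.distrib sum_distrib_left sum_distrib_right mult_ac)
    ultimately have "(\<Sum>i\<in>UNIV. (1 / r * (t - t') $ i)\<^sup>2) + (sqrt (L / r) * (additive_sheet w t - additive_sheet w t'))\<^sup>2
        \<le> (\<Sum>i\<in>UNIV. ((t $ i - t' $ i) / r)\<^sup>2 + ?k * L * (v i (t $ i) - v i (t' $ i))\<^sup>2 / r)"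
      using L(1) r(1)
      by (simp add: power_mult_distrib)
    then have "exp (- 2 * pi * (\<Sum>i\<in>UNIV. ((t $ i - t' $ i) / r)\<^sup>2 + ?k * L * (v i (t $ i) - v i (t' $ i))\<^sup>2 / r))
        \<le> (gaussian ?a ((t, additive_sheet w t) - (t', additive_sheet w t')))\<^sup>2"
      by (simp add: gaussian_weights exp_double[symmetric])
    then show ?thesis
      using True by (simp add: h_def unit_cube_def prod_ennreal exp_sum[symmetric] sum_distrib_left ennreal_leI)
  next
    case False
    then obtain i where "t' $ i \<notin> {0..1}" by (auto simp: unit_cube_def)
    then have "h i (t $ i) (t' $ i) = 0"
      by (simp add: h_def)
    then have "(\<Prod>i\<in>UNIV. h i (t $ i) (t' $ i)) = 0"
      by (intro prod_zero) auto
    then show ?thesis by (simp only: zero_le)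
  qed
  have "ennreal ((exp (- 2 * pi) * r / 2) ^ CARD('k)) = (\<Prod>i\<in>(UNIV :: 'k set). ennreal (exp (- 2 * pi) * r / 2))"
    using r by (simp add: ennreal_power)
  also have "\<dots> \<le> (\<Prod>i\<in>UNIV. \<integral>\<^sup>+a. H i a \<partial>lborel)"
  proof (rule prod_mono_ennreal)
    fix i
    have "ennreal (exp (- 2 * pi) * r / 2) \<le> (\<integral>\<^sup>+a\<in>{0..1}. (\<integral>\<^sup>+b\<in>{0..1}.
        ennreal (exp (- 2 * pi * (((a - b) / r)\<^sup>2 + ?k * L * (w i a - w i b)\<^sup>2 / r))) \<partial>lborel) \<partial>lborel)"
      \<comment> \<open>The one-dimensional bound is used with \<open>?k * L\<close> as its
        constant, which accounts for the form of the assumption on \<open>L\<close>.\<close>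
      by (rule gaussian_mass_near_diagonal[OF w r _ L(2) K]) (use L(1) in simp)
    also have "\<dots> = (\<integral>\<^sup>+a. H i a \<partial>lborel)"
      unfolding H_def h_def
      by (intro nn_integral_cong) (auto simp: indicator_def v intro!: nn_integral_cong)
    finally show "ennreal (exp (- 2 * pi) * r / 2) \<le> (\<integral>\<^sup>+a. H i a \<partial>lborel)" .
  qed
  also have "\<dots> = (\<integral>\<^sup>+t. (\<Prod>i\<in>UNIV. H i (t $ i)) \<partial>lborel)"
    by (rule nn_integral_prod_cart[symmetric]) simp
  also have "\<dots> = (\<integral>\<^sup>+t\<in>unit_cube. (\<integral>\<^sup>+t'. (\<Prod>i\<in>UNIV. h i (t $ i) (t' $ i)) \<partial>lborel) \<partial>lborel)"
    by (subst nn_integral_prod_cart) (simp_all add: H_def prod.distrib indicator_unit_cube)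
  also have "\<dots> \<le> (\<integral>\<^sup>+t\<in>unit_cube. (\<integral>\<^sup>+t'\<in>unit_cube.
      ennreal ((gaussian ?a ((t, additive_sheet w t) - (t', additive_sheet w t')))\<^sup>2) \<partial>lborel) \<partial>lborel)"
  proof (rule nn_integral_mono)
    fix t :: "real ^ 'k"
    show "(\<integral>\<^sup>+t'. (\<Prod>i\<in>UNIV. h i (t $ i) (t' $ i)) \<partial>lborel) * indicator unit_cube t
      \<le> (\<integral>\<^sup>+t'\<in>unit_cube. ennreal ((gaussian ?a ((t, additive_sheet w t) - (t', additive_sheet w t')))\<^sup>2) \<partial>lborel)
        * indicator unit_cube t"
    proof (cases "t \<in> unit_cube")
      case True
      show ?thesis by (intro mult_right_mono nn_integral_mono pt True) simp
    qed simp
  qed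
  also have "\<dots> = (\<integral>\<^sup>+t\<in>unit_cube. (\<integral>\<^sup>+y. ennreal ((gaussian ?a ((t, additive_sheet w t) - y))\<^sup>2) \<partial>\<mu>) \<partial>lborel)"
    unfolding \<mu>_def by (subst nn_integral_surface_measure[OF X]) simp_all
  also have "\<dots> = (\<integral>\<^sup>+x. (\<integral>\<^sup>+y. ennreal ((gaussian ?a (x - y))\<^sup>2) \<partial>\<mu>) \<partial>\<mu>)"
  proof -
    interpret prob_space \<mu>
      unfolding \<mu>_def by (rule prob_space_surface_measure[OF X])
    have [measurable_cong]: "sets \<mu> = sets borel"
      by (simp add: \<mu>_def)
    have "(\<lambda>x. \<integral>\<^sup>+y. ennreal ((gaussian ?a (x - y))\<^sup>2) \<partial>\<mu>) \<in> borel_measurable borel"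
      by measurable
    then show ?thesis
      unfolding \<mu>_def by (subst nn_integral_surface_measure[OF X]) simp_all
  qed
  finally show ?thesis .
qed

section \<open>Extension estimates\<close>

lemma borel_measurable_cis [measurable]: "cis \<in> borel_measurable borel"
  by (intro borel_measurable_continuous_onI continuous_intros)

text \<open>Multiplying the transform by its conjugate gives the transform of the law of the
  difference of two independent points of \<open>\<mu>\<close>.\<close>

lemma fourier_one_sq:
  assumes "prob_space \<mu>" and [measurable_cong]: "sets \<mu> = sets borel"
  shows "complex_of_real ((norm (fourier \<mu> (\<lambda>_. 1) \<xi>))\<^sup>2)
    = (LINT p|(\<mu> \<Otimes>\<^sub>M \<mu>). cis (- 2 * pi * (\<xi> \<bullet> (fst p - snd p))))"
proof -
  interpret prob_space \<mu> by fact
  interpret P: pair_prob_space \<mu> \<mu> ..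
  have int: "integrable (\<mu> \<Otimes>\<^sub>M \<mu>) (\<lambda>p. cis (- 2 * pi * (\<xi> \<bullet> (fst p - snd p))))"
    by (rule P.P.integrable_const_bound[of _ 1]) auto
  let ?F = "fourier \<mu> (\<lambda>_. 1) \<xi>"
  have "complex_of_real ((norm ?F)\<^sup>2) = ?F * cnj ?F"
    by (rule complex_norm_square)
  also have "\<dots> = (LINT x|\<mu>. cis (- 2 * pi * (\<xi> \<bullet> x)) * (LINT y|\<mu>. cis (2 * pi * (\<xi> \<bullet> y))))"
    by (simp add: fourier_def cis_cnj flip: Bochner_Integration.integral_cnj)
  also have "\<dots> = (LINT x|\<mu>. LINT y|\<mu>. cis (- 2 * pi * (\<xi> \<bullet> (x - y))))"
    by (simp add: cis_mult inner_diff_right right_diff_distrib flip: integral_mult_right_zero)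
  also have "\<dots> = (LINT p|(\<mu> \<Otimes>\<^sub>M \<mu>). cis (- 2 * pi * (\<xi> \<bullet> (fst p - snd p))))"
    using P.integral_fst'[OF int] by simp
  finally show ?thesis .
qed

lemma norm_fourier_one_le_1:
  assumes "prob_space \<mu>"
  shows "norm (fourier \<mu> (\<lambda>_. 1) \<xi>) \<le> 1"
proof -
  interpret prob_space \<mu> by fact
  have "norm (fourier \<mu> (\<lambda>_. 1) \<xi>) \<le> (LINT x|\<mu>. norm (cis (- 2 * pi * (\<xi> \<bullet> x)) * 1))"
    unfolding fourier_def by (rule integral_norm_bound)
  then show ?thesis by (simp add: prob_space)
qed

lemma borel_measurable_fourier_one:
  assumes "prob_space \<mu>" and [measurable_cong]: "sets \<mu> = sets borel"
  shows "fourier \<mu> (\<lambda>_. 1) \<in> borel_measurable borel"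
proof -
  interpret prob_space \<mu> by fact
  show ?thesis unfolding fourier_def by measurable
qed

text \<open>Expanding the squared modulus as a double integral and applying Fubini leaves the
  Fourier transform of the Gaussian at x - y. This converts frequency mass into spatial
  energy.\<close>

lemma energy_identity:
  fixes \<mu> :: "'a::euclidean_space measure"
  assumes \<mu>: "prob_space \<mu>" and sets [measurable_cong]: "sets \<mu> = sets borel"
    and a: "\<And>b. b \<in> Basis \<Longrightarrow> 0 < a b"
  shows "(\<integral>\<^sup>+\<xi>. ennreal ((norm (fourier \<mu> (\<lambda>_. 1) \<xi>))\<^sup>2 * gaussian a \<xi>) \<partial>lborel)
    = ennreal (\<Prod>b\<in>Basis. inverse (a b)) *
      (\<integral>\<^sup>+x. (\<integral>\<^sup>+y. ennreal (gaussian (\<lambda>b. inverse (a b)) (x - y)) \<partial>\<mu>) \<partial>\<mu>)"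
proof -
  interpret prob_space \<mu> by fact
  interpret P: pair_prob_space \<mu> \<mu> ..
  interpret Q: pair_sigma_finite "lborel :: 'a measure" "\<mu> \<Otimes>\<^sub>M \<mu>" ..
  define C where "C = (\<Prod>b\<in>Basis. inverse (a b))"
  have C: "0 \<le> C" unfolding C_def using a by (intro prod_nonneg) (simp add: less_imp_le)
  let ?g = "gaussian (\<lambda>b. inverse (a b))"
  let ?F = "fourier \<mu> (\<lambda>_. 1)"
  let ?h = "\<lambda>\<xi> p. cis (- 2 * pi * (\<xi> \<bullet> (fst p - snd p))) * gaussian a \<xi>"
  have [measurable]: "?F \<in> borel_measurable borel"
    by (rule borel_measurable_fourier_one[OF \<mu> sets])
  \<comment> \<open>The character has modulus 1, the Gaussian is integrable and the product measure
    has mass 1, so Fubini is justified.\<close>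
  have int: "integrable (lborel \<Otimes>\<^sub>M (\<mu> \<Otimes>\<^sub>M \<mu>)) (\<lambda>(\<xi>, p). ?h \<xi> p)"
  proof (rule Q.Fubini_integrable)
    show "integrable lborel (\<lambda>\<xi>. LINT p|(\<mu> \<Otimes>\<^sub>M \<mu>). norm (case (\<xi>, p) of (\<xi>, p) \<Rightarrow> ?h \<xi> p))"
      using integrable_gaussian[OF a] gaussian_pos[of a]
      by (simp add: norm_mult P.P.prob_space abs_of_pos)
    have "integrable (\<mu> \<Otimes>\<^sub>M \<mu>) (\<lambda>p. ?h \<xi> p)" for \<xi>
      using gaussian_le_1[of a \<xi>] gaussian_pos[of a \<xi>]
      by (intro P.P.integrable_const_bound[of _ 1]) (auto simp: norm_mult)
    then show "AE \<xi> in lborel. integrable (\<mu> \<Otimes>\<^sub>M \<mu>) (\<lambda>p. case (\<xi>, p) of (\<xi>, p) \<Rightarrow> ?h \<xi> p)"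
      by simp
  qed measurable
  have intF: "integrable lborel (\<lambda>\<xi>. (norm (?F \<xi>))\<^sup>2 * gaussian a \<xi>)"
    using norm_fourier_one_le_1[OF \<mu>] gaussian_pos[of a]
    by (intro Bochner_Integration.integrable_bound[OF integrable_gaussian[OF a]])
      (auto simp: abs_mult power_le_one mult_left_le_one_le less_imp_le)
  have intg: "integrable (\<mu> \<Otimes>\<^sub>M \<mu>) (\<lambda>p. ?g (fst p - snd p))"
    by (rule P.P.integrable_const_bound[of _ 1]) (simp_all add: abs_of_pos gaussian_pos gaussian_le_1)
  have "complex_of_real (LINT \<xi>|lborel. (norm (?F \<xi>))\<^sup>2 * gaussian a \<xi>)
      = (LINT \<xi>|lborel. of_real ((norm (?F \<xi>))\<^sup>2) * of_real (gaussian a \<xi>))"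
    unfolding of_real_mult[symmetric] by (rule integral_complex_of_real[symmetric])
  also have "\<dots> = (LINT \<xi>|lborel. LINT p|(\<mu> \<Otimes>\<^sub>M \<mu>). ?h \<xi> p)"
    unfolding fourier_one_sq[OF \<mu> sets] by simp
  also have "\<dots> = (LINT p|(\<mu> \<Otimes>\<^sub>M \<mu>). LINT \<xi>|lborel. ?h \<xi> p)"
    by (rule Q.Fubini_integral[OF int, symmetric])
  also have "\<dots> = (LINT p|(\<mu> \<Otimes>\<^sub>M \<mu>). of_real (C * ?g (fst p - snd p)))"
  proof (intro Bochner_Integration.integral_cong refl)
    fix p :: "'a \<times> 'a"
    have "(LINT \<xi>|lborel. ?h \<xi> p) = fourier lborel (\<lambda>x. gaussian a x) (fst p - snd p)"
      by (simp only: fourier_def inner_commute)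
    also have "\<dots> = of_real (C * ?g (fst p - snd p))"
      unfolding C_def by (rule fourier_gaussian) (rule a)
    finally show "(LINT \<xi>|lborel. ?h \<xi> p) = of_real (C * ?g (fst p - snd p))" .
  qed
  also have "\<dots> = of_real (C * (LINT p|(\<mu> \<Otimes>\<^sub>M \<mu>). ?g (fst p - snd p)))"
    by simp
  finally have eq: "(LINT \<xi>|lborel. (norm (?F \<xi>))\<^sup>2 * gaussian a \<xi>)
      = C * (LINT p|(\<mu> \<Otimes>\<^sub>M \<mu>). ?g (fst p - snd p))"
    using of_real_eq_iff by blast
  have "(\<integral>\<^sup>+\<xi>. ennreal ((norm (?F \<xi>))\<^sup>2 * gaussian a \<xi>) \<partial>lborel)
      = ennreal (C * (LINT p|(\<mu> \<Otimes>\<^sub>M \<mu>). ?g (fst p - snd p)))"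
    unfolding eq[symmetric] using gaussian_pos[of a]
    by (intro nn_integral_eq_integral intF) (simp add: less_imp_le)
  also have "\<dots> = ennreal C * (\<integral>\<^sup>+p. ennreal (?g (fst p - snd p)) \<partial>(\<mu> \<Otimes>\<^sub>M \<mu>))"
    using C by (subst nn_integral_eq_integral[OF intg])
      (auto simp: less_imp_le[OF gaussian_pos] intro!: ennreal_mult integral_nonneg_AE)
  also have "(\<integral>\<^sup>+p. ennreal (?g (fst p - snd p)) \<partial>(\<mu> \<Otimes>\<^sub>M \<mu>))
      = (\<integral>\<^sup>+x. (\<integral>\<^sup>+y. ennreal (?g (x - y)) \<partial>\<mu>) \<partial>\<mu>)"
    by (subst nn_integral_fst[symmetric]) auto
  finally show ?thesis unfolding C_def .
qed

text \<open>The quotient of the two powers tends to 0 with \<open>r\<close>. Both non-estimates end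
  by contradicting such a comparison of exponents.\<close>

lemma eventually_powr_less:
  fixes r :: "nat \<Rightarrow> real"
  assumes r: "r \<longlonglongrightarrow> 0" "\<And>n. 0 < r n" and "\<alpha> < \<beta>" "0 < c"
  shows "\<forall>\<^sub>F n in sequentially. d * r n powr \<beta> < c * r n powr \<alpha>"
proof -
  have "(\<lambda>n. d * r n powr (\<beta> - \<alpha>)) \<longlonglongrightarrow> d * 0"
    using assms by (intro tendsto_mult_left tendsto_zero_powrI[OF r(1) tendsto_const])
      (auto simp: less_imp_le)
  then have "\<forall>\<^sub>F n in sequentially. d * r n powr (\<beta> - \<alpha>) < c"
    using \<open>0 < c\<close> by (intro order_tendstoD) simp_all
  then show ?thesis
  proof eventually_elim
    case (elim n)
    then have "d * r n powr (\<beta> - \<alpha>) * r n powr \<alpha> < c * r n powr \<alpha>"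
      using r(2)[of n] by simp
    then show ?case by (simp add: mult.assoc flip: powr_add)
  qed
qed

text \<open>Replaces Hoelder's inequality between \<open>L\<^sup>2\<close> and \<open>L\<^sup>q\<close> with respect to the Gaussian weight;
  \<open>\<tau>\<close> is optimised afterwards.\<close>

lemma power2_le_split:
  fixes u \<tau> q :: real
  assumes "0 \<le> u" "0 < \<tau>" "2 < q"
  shows "u\<^sup>2 \<le> \<tau>\<^sup>2 + \<tau> powr (2 - q) * u powr q"
proof (cases "u \<le> \<tau>")
  case True
  then show ?thesis using assms by (simp add: power_mono add_increasing2)
next
  case False
  then have u: "\<tau> < u" "0 < u" using assms by auto
  have "u\<^sup>2 = u powr (2 - q) * u powr q"
    using u by (simp flip: powr_add)
  also have "\<dots> \<le> \<tau> powr (2 - q) * u powr q"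
    using u assms by (intro mult_right_mono powr_mono2') auto
  finally show ?thesis by (simp add: add_increasing)
qed

text \<open>On a probability measure the constant 1 has norm at most 1 for every \<open>p\<close>,
  so testing on it removes \<open>p\<close> from the problem.\<close>

lemma extension_estimate_one:
  fixes \<mu> :: "'a::euclidean_space measure"
  assumes \<mu>: "prob_space \<mu>" and ext: "extension_estimate \<mu> p (ennreal q)" and p: "1 \<le> p" and q: "1 \<le> q"
  shows "(\<integral>\<^sup>+\<xi>. ennreal (norm (fourier \<mu> (\<lambda>_. 1) \<xi>) powr q) \<partial>lborel) < \<top>"
proof -
  interpret prob_space \<mu> by fact
  have 1: "Lp_norm \<mu> p (\<lambda>_. 1) \<le> 1"
  proof (cases "p = \<top>")
    case True
    have "esssup \<mu> (\<lambda>_. 1 :: ennreal) \<le> 1" by (intro esssup_I) auto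
    then show ?thesis using True by (simp add: Lp_norm_def)
  next
    case False
    then show ?thesis by (simp add: Lp_norm_def emeasure_space_1)
  qed
  then have "(\<lambda>_. 1) \<in> Lp_space \<mu> p"
    by (auto simp: Lp_space_def less_top[symmetric] top_unique dest: neq_top_trans[rotated])
  then obtain c where "Lp_norm lborel (ennreal q) (fourier \<mu> (\<lambda>_. 1)) \<le> ennreal c * Lp_norm \<mu> p (\<lambda>_. 1)"
    using ext unfolding extension_estimate_def by blast
  also have "\<dots> \<le> ennreal c * 1"
    using 1 by (rule mult_left_mono) simp
  finally have "Lp_norm lborel (ennreal q) (fourier \<mu> (\<lambda>_. 1)) \<noteq> \<top>"
    by (auto simp: top_unique)
  then show ?thesis
    using q by (auto simp: Lp_norm_def Let_def less_top split: if_splits)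
qed

text \<open>The energy forces a weighted square mass of order r^(-1/2), while finiteness of an L^s
  norm allows only order r^(-k (s - 2) / 2). These conflict as r tends to 0 when k (s - 2) <
  1.\<close>

lemma not_extension_estimate:
  fixes \<mu> :: "((real ^ 'k::finite) \<times> real) measure"
  assumes \<mu>: "prob_space \<mu>" and sets: "sets \<mu> = sets borel"
    and r: "\<And>n. 0 < r n" "r \<longlonglongrightarrow> 0" and c: "0 < c" and L: "0 < L"
    and energy: "\<exists>\<^sub>F n in sequentially. ennreal (c * r n ^ CARD('k)) \<le>
      (\<integral>\<^sup>+x. (\<integral>\<^sup>+y. ennreal ((gaussian (weights (1 / r n) (sqrt (L / r n))) (x - y))\<^sup>2) \<partial>\<mu>) \<partial>\<mu>)"
    and p: "1 \<le> p" and q: "1 \<le> q" "q < ennreal (2 + 1 / CARD('k))"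
  shows "\<not> extension_estimate \<mu> p q"
proof
  assume ext: "extension_estimate \<mu> p q"
  let ?k = "real CARD('k)"
  let ?F = "fourier \<mu> (\<lambda>_. 1)"
  have [measurable]: "?F \<in> borel_measurable borel"
    by (rule borel_measurable_fourier_one[OF \<mu> sets])
  obtain q0 where q0: "q = ennreal q0" "1 \<le> q0" "q0 < 2 + 1 / ?k"
    using q by (cases q) (auto simp: ennreal_less_iff ennreal_le_iff2 ennreal_1[symmetric] simp del: ennreal_1 ennreal_plus)
  \<comment> \<open>Above 2 for the splitting lemma, above \<open>q0\<close> so that integrability
    passes to \<open>s\<close> through the bound 1 on the transform, and below the threshold to give
    k (s - 2) < 1.\<close>
  obtain s where s: "max 2 q0 < s" "s < 2 + 1 / ?k"
    using dense[of "max 2 q0" "2 + 1 / ?k"] q0 by auto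
  then have s2: "2 < s" "?k * (s - 2) < 1"
    by (auto simp: field_simps)
  have "(\<integral>\<^sup>+\<xi>. ennreal (norm (?F \<xi>) powr s) \<partial>lborel) \<le> (\<integral>\<^sup>+\<xi>. ennreal (norm (?F \<xi>) powr q0) \<partial>lborel)"
    using s norm_fourier_one_le_1[OF \<mu>] q0
    by (intro nn_integral_mono ennreal_leI powr_mono') auto
  also have "\<dots> < \<top>"
    using extension_estimate_one[OF \<mu>] ext p q0 by blast
  finally obtain N where N: "0 \<le> N" "(\<integral>\<^sup>+\<xi>. ennreal (norm (?F \<xi>) powr s) \<partial>lborel) = ennreal N"
    by (cases "\<integral>\<^sup>+\<xi>. ennreal (norm (?F \<xi>) powr s) \<partial>lborel") auto
  define D where "D = (c / 2) powr ((2 - s) / 2) * N"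
  have upper: "c / 2 * sqrt L * r n powr (- 1 / 2) \<le> D * r n powr (?k * (2 - s) / 2)"
    if n: "ennreal (c * r n ^ CARD('k)) \<le>
      (\<integral>\<^sup>+x. (\<integral>\<^sup>+y. ennreal ((gaussian (weights (1 / r n) (sqrt (L / r n))) (x - y))\<^sup>2) \<partial>\<mu>) \<partial>\<mu>)" for n
  proof -
    let ?a = "weights (r n) (sqrt (r n / L)) :: (real ^ 'k) \<times> real \<Rightarrow> real"
    have a: "0 < ?a b" for b
      using r(1)[of n] L by (intro weights_pos) auto
    have inv: "(\<lambda>b. inverse (?a b)) = weights (1 / r n) (sqrt (L / r n))"
      by (rule inverse_parabolic_weights)
    define C where "C = (\<Prod>b\<in>Basis. inverse (?a b))"
    have C: "C = sqrt L * r n powr (- (2 * ?k + 1) / 2)"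
      unfolding C_def by (rule prod_inverse_parabolic_weights[OF r(1) L])
    then have "0 < C" using r(1)[of n] L by simp
    \<comment> \<open>With this level the term \<tau>^2 C is exactly half of the lower bound and can
      be absorbed.\<close>
    define \<tau> where "\<tau> = sqrt (c * r n ^ CARD('k) / 2)"
    have \<tau>: "0 < \<tau>" "\<tau>\<^sup>2 = c * r n ^ CARD('k) / 2"
      using c r(1)[of n] by (simp_all add: \<tau>_def)
    have "ennreal (C * (c * r n ^ CARD('k))) = ennreal C * ennreal (c * r n ^ CARD('k))"
      using \<open>0 < C\<close> c r(1)[of n] by (simp add: ennreal_mult)
    also have "\<dots> \<le> ennreal C * (\<integral>\<^sup>+x. (\<integral>\<^sup>+y. ennreal (gaussian (\<lambda>b. inverse (?a b)) (x - y)) \<partial>\<mu>) \<partial>\<mu>)"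
      \<comment> \<open>The energy is stated for the squared Gaussian, which is below the Gaussian
        itself because its values are at most 1.\<close>
      unfolding inv
      by (intro mult_left_mono order_trans[OF n] nn_integral_mono ennreal_leI)
        (auto simp: power2_eq_square gaussian_le_1 gaussian_pos less_imp_le mult_left_le)
    also have "\<dots> = (\<integral>\<^sup>+\<xi>. ennreal ((norm (?F \<xi>))\<^sup>2 * gaussian ?a \<xi>) \<partial>lborel)"
      unfolding C_def by (rule energy_identity[OF \<mu> sets a, symmetric])
    also have "\<dots> \<le> (\<integral>\<^sup>+\<xi>. ennreal (\<tau>\<^sup>2) * ennreal (gaussian ?a \<xi>)
        + ennreal (\<tau> powr (2 - s)) * ennreal (norm (?F \<xi>) powr s) \<partial>lborel)"
    proof (rule nn_integral_mono)
      fix \<xi>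
      have "(norm (?F \<xi>))\<^sup>2 * gaussian ?a \<xi>
          \<le> (\<tau>\<^sup>2 + \<tau> powr (2 - s) * norm (?F \<xi>) powr s) * gaussian ?a \<xi>"
        using power2_le_split[OF norm_ge_zero \<tau>(1) s2(1)] gaussian_pos[of ?a \<xi>]
        by (intro mult_right_mono) auto
      also have "\<dots> \<le> \<tau>\<^sup>2 * gaussian ?a \<xi> + \<tau> powr (2 - s) * norm (?F \<xi>) powr s"
        using gaussian_le_1[of ?a \<xi>] gaussian_pos[of ?a \<xi>]
        by (simp add: distrib_right mult_left_le)
      finally show "ennreal ((norm (?F \<xi>))\<^sup>2 * gaussian ?a \<xi>)
          \<le> ennreal (\<tau>\<^sup>2) * ennreal (gaussian ?a \<xi>) + ennreal (\<tau> powr (2 - s)) * ennreal (norm (?F \<xi>) powr s)"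
        using gaussian_pos[of ?a \<xi>]
        by (simp add: ennreal_mult[symmetric] ennreal_plus[symmetric] less_imp_le ennreal_leI del: ennreal_plus)
    qed
    also have "\<dots> = ennreal (\<tau>\<^sup>2) * ennreal C + ennreal (\<tau> powr (2 - s)) * ennreal N"
      by (simp add: nn_integral_add nn_integral_cmult N nn_integral_gaussian[OF a] C_def)
    also have "\<dots> = ennreal (\<tau>\<^sup>2 * C + \<tau> powr (2 - s) * N)"
      using \<open>0 < C\<close> N(1) by (simp add: ennreal_mult)
    finally have "C * (c * r n ^ CARD('k)) \<le> \<tau>\<^sup>2 * C + \<tau> powr (2 - s) * N"
      using \<open>0 < C\<close> N(1) by (subst (asm) ennreal_le_iff) auto
    then have "C * (c * r n ^ CARD('k)) / 2 \<le> \<tau> powr (2 - s) * N"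
      by (simp add: \<tau>(2) algebra_simps)
    moreover have "C * (c * r n ^ CARD('k)) / 2 = c / 2 * sqrt L * r n powr (- 1 / 2)"
      using r(1)[of n] by (simp add: C add_divide_distrib diff_divide_distrib mult_ac flip: powr_realpow powr_add)
    moreover have "\<tau> powr (2 - s) = (c / 2) powr ((2 - s) / 2) * r n powr (?k * (2 - s) / 2)"
    proof -
      have "\<tau> = ((c / 2) * r n powr ?k) powr (1 / 2)"
        using c r(1)[of n] by (simp add: \<tau>_def powr_half_sqrt powr_realpow)
      then show ?thesis
        using c r(1)[of n] by (simp add: powr_powr powr_mult powr_divide)
    qed
    ultimately show ?thesis by (simp add: D_def mult_ac)
  qed
  have "\<forall>\<^sub>F n in sequentially. D * r n powr (?k * (2 - s) / 2) < c / 2 * sqrt L * r n powr (- 1 / 2)"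
    \<comment> \<open>The inequality of exponents -1/2 < k (2 - s) / 2 is k (s - 2) < 1
      rewritten.\<close>
    using s2(2) c L by (intro eventually_powr_less r) (auto simp: algebra_simps)
  from frequently_ex[OF frequently_eventually_frequently[OF energy this]] show False
    by (elim exE conjE) (drule upper, linarith)
qed

section \<open>Restriction estimates\<close>

text \<open>For values bounded by 1, raising to a power \<open>p\<close> of at least 1 only
  decreases the integrand. At infinity the exponent 0 gives the bound 1.\<close>

lemma Lp_norm_le_of_bounded:
  fixes f :: "'a \<Rightarrow> complex"
  assumes [measurable]: "f \<in> borel_measurable M" and f: "\<And>x. norm (f x) \<le> 1"
    and C: "(\<integral>\<^sup>+x. ennreal (norm (f x)) \<partial>M) \<le> ennreal C" "0 < C" and p: "1 \<le> p"
  shows "Lp_norm M p f \<le> ennreal (C powr (if p = \<top> then 0 else 1 / enn2real p))"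
proof (cases "p = \<top>")
  case True
  have "esssup M (\<lambda>x. ennreal (norm (f x))) \<le> 1"
    using f by (intro esssup_I) auto
  then show ?thesis using True C by (simp add: Lp_norm_def)
next
  case False
  then have p1: "1 \<le> enn2real p"
    using p by (cases p) (auto simp: ennreal_1[symmetric] ennreal_le_iff2 simp del: ennreal_1)
  define I where "I = (\<integral>\<^sup>+x. ennreal (norm (f x) powr enn2real p) \<partial>M)"
  have "norm (f x) powr enn2real p \<le> norm (f x)" for x
    using powr_mono'[OF p1 norm_ge_zero f] by simp
  then have "I \<le> (\<integral>\<^sup>+x. ennreal (norm (f x)) \<partial>M)"
    unfolding I_def by (intro nn_integral_mono ennreal_leI)
  then have I: "I \<le> ennreal C" using C(1) by (rule order_trans)
  then have "I \<noteq> \<top>" by (auto simp: top_unique)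
  moreover have "enn2real I \<le> C"
    using enn2real_mono[OF I] C by simp
  ultimately show ?thesis
    using False p1 by (auto simp: Lp_norm_def Let_def I_def[symmetric] intro!: ennreal_leI powr_mono2)
qed

lemma nn_integral_square_le_of_Lp_norm:
  assumes "Lp_norm M 2 f \<le> ennreal D" "0 \<le> D"
  shows "(\<integral>\<^sup>+x. ennreal ((norm (f x))\<^sup>2) \<partial>M) \<le> ennreal (D\<^sup>2)"
proof -
  define I where "I = (\<integral>\<^sup>+x. ennreal ((norm (f x))\<^sup>2) \<partial>M)"
  have N: "Lp_norm M 2 f = (if I = \<top> then \<top> else ennreal (sqrt (enn2real I)))"
    by (simp add: Lp_norm_def I_def powr_half_sqrt)
  then have I: "I \<noteq> \<top>" using assms(1) by (auto simp: top_unique)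
  then have "sqrt (enn2real I) \<le> D"
    using N assms by simp
  then have "enn2real I \<le> D\<^sup>2"
    using sqrt_le_D by blast
  then show ?thesis
    using I unfolding I_def[symmetric] by (cases I) (auto intro: ennreal_leI)
qed

text \<open>For a Gaussian modulated by z the estimate bounds the square mass of its transform, a
  peak of height C around z. Averaging over z in \<open>\<mu>\<close> produces the energy, hence C^2
  c r^k <= B'^2 C^(2e), where C has order r^(-(2k+1)/2); the condition on \<open>p\<close> makes
  this fail for small r.\<close>

lemma not_restriction_estimate:
  fixes \<mu> :: "((real ^ 'k::finite) \<times> real) measure"
  assumes \<mu>: "prob_space \<mu>" and sets: "sets \<mu> = sets borel"
    and r: "\<And>n. 0 < r n" "r \<longlonglongrightarrow> 0" and c: "0 < c" and L: "0 < L"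
    and energy: "\<exists>\<^sub>F n in sequentially. ennreal (c * r n ^ CARD('k)) \<le>
      (\<integral>\<^sup>+x. (\<integral>\<^sup>+y. ennreal ((gaussian (weights (1 / r n) (sqrt (L / r n))) (x - y))\<^sup>2) \<partial>\<mu>) \<partial>\<mu>)"
    and p: "p > ennreal ((2 * real CARD('k) + 1) / (real CARD('k) + 1))"
  shows "\<not> restriction_estimate \<mu> p"
proof
  assume "restriction_estimate \<mu> p"
  then obtain B where B: "\<And>f. schwartz f \<Longrightarrow> Lp_norm \<mu> 2 (fourier lborel f) \<le> ennreal B * Lp_norm lborel p f"
    unfolding restriction_estimate_def by blast
  interpret prob_space \<mu> by fact
  let ?k = "real CARD('k)"
  \<comment> \<open>The reciprocal of \<open>p\<close>, with value 0 at infinity.\<close>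
  define e where "e = (if p = \<top> then 0 else 1 / enn2real p)"
  have p1: "1 \<le> p"
  proof -
    have "ennreal 1 \<le> ennreal ((2 * ?k + 1) / (?k + 1))"
      by (intro ennreal_leI) (simp add: field_simps)
    then show ?thesis using order_trans[OF _ less_imp_le[OF p], of 1] by simp
  qed
  have e: "(2 * ?k + 1) * e < ?k + 1"
  proof (cases p)
    case (real x)
    then have "(2 * ?k + 1) / (?k + 1) < x"
      using p by (simp add: ennreal_less_iff)
    moreover from this have "0 < x"
      by (rule le_less_trans[rotated]) simp
    ultimately show ?thesis
      using real by (simp add: e_def field_simps)
  qed (simp add: e_def)
  \<comment> \<open>A negative constant is read as 0 by \<open>ennreal\<close>, so the truncation
    leaves the estimate intact and allows real arithmetic.\<close>
  define B' where "B' = max 0 B"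
  define D where "D = (B' * sqrt L powr e)\<^sup>2"
  have upper: "c * L * r n powr (- ?k - 1) \<le> D * r n powr (- (2 * ?k + 1) * e)"
    if n: "ennreal (c * r n ^ CARD('k)) \<le>
      (\<integral>\<^sup>+x. (\<integral>\<^sup>+y. ennreal ((gaussian (weights (1 / r n) (sqrt (L / r n))) (x - y))\<^sup>2) \<partial>\<mu>) \<partial>\<mu>)" for n
  proof -
    let ?a = "weights (r n) (sqrt (r n / L)) :: (real ^ 'k) \<times> real \<Rightarrow> real"
    have a: "0 < ?a b" for b
      using r(1)[of n] L by (intro weights_pos) auto
    have inv: "(\<lambda>b. inverse (?a b)) = weights (1 / r n) (sqrt (L / r n))"
      by (rule inverse_parabolic_weights)
    define C where "C = (\<Prod>b\<in>Basis. inverse (?a b))"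
    have C: "C = sqrt L * r n powr (- (2 * ?k + 1) / 2)"
      unfolding C_def by (rule prod_inverse_parabolic_weights[OF r(1) L])
    then have C0: "0 < C" using r(1)[of n] L by simp
    let ?g = "gaussian (weights (1 / r n) (sqrt (L / r n)))"
    \<comment> \<open>Uniform in the centre \<open>z\<close>, since modulation changes neither the
      modulus of the test function nor its norm.\<close>
    have bound: "(\<integral>\<^sup>+x. ennreal ((C * ?g (x - z))\<^sup>2) \<partial>\<mu>) \<le> ennreal ((B' * C powr e)\<^sup>2)" for z
    proof -
      define f where "f x = cis (2 * pi * (z \<bullet> x)) * gaussian ?a x" for x
      have [measurable]: "f \<in> borel_measurable borel"
        unfolding f_def by measurable
      have nf: "norm (f x) = gaussian ?a x" for x
        using gaussian_pos[of ?a x] by (simp add: f_def norm_mult)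
      have F: "fourier lborel f \<xi> = of_real (C * ?g (\<xi> - z))" for \<xi>
        unfolding f_def fourier_modulation fourier_gaussian[OF a] inv C_def ..
      have "Lp_norm \<mu> 2 (fourier lborel f) \<le> ennreal B * Lp_norm lborel p f"
        unfolding f_def by (intro B schwartz_modulated_gaussian a)
      also have "\<dots> \<le> ennreal B' * ennreal (C powr e)"
        unfolding e_def using C0 p1
        by (intro mult_mono Lp_norm_le_of_bounded)
          (auto simp: nf gaussian_le_1 nn_integral_gaussian[OF a] C_def[symmetric] B'_def intro: ennreal_leI)
      also have "\<dots> = ennreal (B' * C powr e)"
        by (simp add: B'_def ennreal_mult)
      finally have "(\<integral>\<^sup>+x. ennreal ((norm (fourier lborel f x))\<^sup>2) \<partial>\<mu>) \<le> ennreal ((B' * C powr e)\<^sup>2)"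
        by (rule nn_integral_square_le_of_Lp_norm) (simp add: B'_def)
      then show ?thesis by (simp add: F norm_mult power_mult_distrib)
    qed
    have "ennreal (C\<^sup>2 * (c * r n ^ CARD('k))) = ennreal (C\<^sup>2) * ennreal (c * r n ^ CARD('k))"
      using c r(1)[of n] by (simp add: ennreal_mult)
    also have "\<dots> \<le> ennreal (C\<^sup>2) * (\<integral>\<^sup>+x. (\<integral>\<^sup>+y. ennreal ((?g (x - y))\<^sup>2) \<partial>\<mu>) \<partial>\<mu>)"
      by (intro mult_left_mono n) simp
    also have "\<dots> = (\<integral>\<^sup>+x. (\<integral>\<^sup>+y. ennreal ((C * ?g (y - x))\<^sup>2) \<partial>\<mu>) \<partial>\<mu>)"
    proof -
      note [measurable_cong] = sets
      \<comment> \<open>Evenness of the Gaussian lets the outer variable play the role of the centre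
        \<open>z\<close>.\<close>
      have "(C * ?g (y - x))\<^sup>2 = C\<^sup>2 * (?g (x - y))\<^sup>2" for x y :: "(real ^ 'k) \<times> real"
        using gaussian_minus[of _ "x - y"] by (simp add: power_mult_distrib)
      then show ?thesis by (simp add: ennreal_mult nn_integral_cmult)
    qed
    also have "\<dots> \<le> (\<integral>\<^sup>+x. ennreal ((B' * C powr e)\<^sup>2) \<partial>\<mu>)"
      by (intro nn_integral_mono bound)
    also have "\<dots> = ennreal ((B' * C powr e)\<^sup>2)"
      by (simp add: emeasure_space_1)
    finally have "C\<^sup>2 * (c * r n ^ CARD('k)) \<le> (B' * C powr e)\<^sup>2"
      by (subst (asm) ennreal_le_iff) auto
    moreover have "C\<^sup>2 * (c * r n ^ CARD('k)) = c * L * r n powr (- ?k - 1)"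
    proof -
      have "C\<^sup>2 = L * r n powr (- (2 * ?k + 1))"
        using L by (simp add: C power_mult_distrib power2_eq_square[of "_ powr _"] flip: powr_add)
      moreover have "r n powr (- ?k - 1) = r n powr (- (2 * ?k + 1)) * r n powr ?k"
        by (simp flip: powr_add)
      ultimately show ?thesis
        using r(1)[of n] by (simp add: powr_realpow)
    qed
    moreover have "(B' * C powr e)\<^sup>2 = D * r n powr (- (2 * ?k + 1) * e)"
    proof -
      have "C powr e = sqrt L powr e * r n powr (- (2 * ?k + 1) / 2 * e)"
        using L r(1)[of n] by (simp add: C powr_mult powr_powr)
      moreover have "(r n powr (- (2 * ?k + 1) / 2 * e))\<^sup>2 = r n powr (- (2 * ?k + 1) * e)"
        by (simp add: power2_eq_square mult.commute[of e] flip: powr_add)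
      ultimately show ?thesis
        by (simp add: D_def power_mult_distrib)
    qed
    ultimately show ?thesis by simp
  qed
  have "\<forall>\<^sub>F n in sequentially. D * r n powr (- (2 * ?k + 1) * e) < c * L * r n powr (- ?k - 1)"
    \<comment> \<open>The required inequality -k - 1 < -(2k + 1) e is the condition on
      \<open>p\<close>.\<close>
    using e c L by (intro eventually_powr_less r) (auto simp: algebra_simps)
  from frequently_ex[OF frequently_eventually_frequently[OF energy this]] show False
    by (elim exE conjE) (drule upper, linarith)
qed

section \<open>Both failures on a common almost sure event\<close>

theorem corollary2p5:
  fixes M :: "'w measure" and W :: "'k::finite \<Rightarrow> real \<Rightarrow> 'w \<Rightarrow> real"
  assumes "independent_brownian_motions M W"
  shows "AE \<omega> in M.
    (let \<mu> = surface_measure (additive_sheet (\<lambda>i t. W i t \<omega>));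
         k = real CARD('k)
     in (\<forall>p q. 1 \<le> p \<and> 1 \<le> q \<and> q < ennreal (2 + 1 / k) \<longrightarrow>
           \<not> extension_estimate \<mu> p q) \<and>
        (\<forall>q q'. hoelder_conjugate q q' \<and> q' > ennreal ((2 * k + 1) / (k + 1)) \<longrightarrow>
           \<not> restriction_estimate \<mu> q'))"
proof -
  define r where "r n = inverse (real (Suc n))" for n
  have r: "0 < r n" "r n \<le> 1" for n
    by (auto simp: r_def inverse_le_1_iff)
  have r0: "r \<longlonglongrightarrow> 0"
    unfolding r_def by (rule LIMSEQ_inverse_real_of_nat)
  have W: "standard_brownian_motion M (W i)" for i
    using assms by (simp add: independent_brownian_motions_def)
  \<comment> \<open>The almost sure event is fixed before the exponents, so a single null set serves
    all of them.\<close>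
  from frequently_oscillation_bounded[of M W r, OF W r] show ?thesis
  proof eventually_elim
    case (elim \<omega>)
    then have w: "\<And>i. continuous_on {0..1} (\<lambda>t. W i t \<omega>)" by blast
    from elim obtain K where K: "K > 0"
      "\<exists>\<^sub>F n in sequentially. \<forall>i. oscillation (\<lambda>t. W i t \<omega>) (r n) \<le> ennreal (K * (r n)\<^sup>2)" by blast
    define \<mu> where "\<mu> = surface_measure (additive_sheet (\<lambda>i t. W i t \<omega>))"
    have \<mu>: "prob_space \<mu>" "sets \<mu> = sets borel"
      by (simp_all add: \<mu>_def prob_space_surface_measure continuous_on_additive_sheet w)
    \<comment> \<open>Chosen to turn the smallness condition of \<open>energy_lower_bound\<close>
      into an equality; it depends on the path through \<open>K\<close>.\<close>
    define L where "L = 1 / (4 * pi * CARD('k) * K)"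
    have L: "0 < L" "4 * pi * (CARD('k) * L) * K \<le> 1"
      using K(1) by (simp_all add: L_def)
    \<comment> \<open>The lower bound (e^(-2 pi) r / 2)^k with the power r^k taken out.\<close>
    define c where "c = (exp (- 2 * pi) / 2) ^ CARD('k)"
    have c: "0 < c" by (simp add: c_def)
    from K(2) have energy: "\<exists>\<^sub>F n in sequentially. ennreal (c * r n ^ CARD('k)) \<le>
        (\<integral>\<^sup>+x. (\<integral>\<^sup>+y. ennreal ((gaussian (weights (1 / r n) (sqrt (L / r n))) (x - y))\<^sup>2) \<partial>\<mu>) \<partial>\<mu>)"
    proof (rule frequently_elim1)
      fix n
      assume "\<forall>i. oscillation (\<lambda>t. W i t \<omega>) (r n) \<le> ennreal (K * (r n)\<^sup>2)"
      then show "ennreal (c * r n ^ CARD('k)) \<le>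
          (\<integral>\<^sup>+x. (\<integral>\<^sup>+y. ennreal ((gaussian (weights (1 / r n) (sqrt (L / r n))) (x - y))\<^sup>2) \<partial>\<mu>) \<partial>\<mu>)"
        using energy_lower_bound[of "\<lambda>i t. W i t \<omega>" "r n" L K, OF w r L]
        by (simp add: \<mu>_def c_def power_mult_distrib power_divide)
    qed
    show ?case
      unfolding Let_def \<mu>_def[symmetric]
      using not_extension_estimate[OF \<mu> r(1) r0 c L(1) energy]
        not_restriction_estimate[OF \<mu> r(1) r0 c L(1) energy] by blast
  qed
qed

end
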